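(* Let $R$ be a Dedekind domain, let $m$ be a positive integer, and let $I=P_1^{\alpha_1}\cdots P_m^{\alpha_m}J$ be a nonzero ideal with $R/I$ finite, where $P_1,\ldots,P_m$ are distinct prime ideals with $|R/P_i|=2$, $\alpha_1,\ldots,\alpha_m$ are positive integers, and $J$ is an ideal of $R$ not divisible by any prime ideal of index $2$. If $J=R$ and $\alpha_i=1$ for all $i$, then every connected component of $G_{R/I}$ has diameter $1$. If $J=R$ and $\alpha_i>1$ for some $i$, then every connected component of $G_{R/I}$ has diameter $2$. If $J\neq R$, then every connected component of $G_{R/I}$ has diameter $3$.
   Context: $G_{R/I}$ is the unitary Cayley graph of $R/I$: vertex set $R/I$, with $a+I$, $b+I$ adjacent iff $a-b+I$ is a unit of $R/I$. *)

theory Defs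
  imports
    "HOL-Algebra.Ring_Divisibility"
    "HOL-Algebra.Ideal_Product"
    "HOL-Algebra.QuotRing"
    "HOL-Algebra.Polynomials"
    "Graph_Theory.Digraph_Component"
    "Graph_Theory.Shortest_Path"
begin

section \<open>Dedekind domains\<close>

text \<open>The fraction a/s is the equivalence class of all pairs (b, t) with a/s = b/t.\<close>

definition fraction :: "('a, 'b) ring_scheme \<Rightarrow> 'a \<Rightarrow> 'a \<Rightarrow> ('a \<times> 'a) set" where
  "fraction R a s =
     {(b, t). b \<in> carrier R \<and> t \<in> carrier R - {\<zero>\<^bsub>R\<^esub>} \<and> a \<otimes>\<^bsub>R\<^esub> t = b \<otimes>\<^bsub>R\<^esub> s}"

definition fraction_field :: "('a, 'b) ring_scheme \<Rightarrow> ('a \<times> 'a) set ring" where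
  "fraction_field R =
     \<lparr> carrier = {fraction R a s | a s. a \<in> carrier R \<and> s \<in> carrier R - {\<zero>\<^bsub>R\<^esub>}},
       monoid.mult = (\<lambda>F G. \<Union>(a, s) \<in> F. \<Union>(b, t) \<in> G. fraction R (a \<otimes>\<^bsub>R\<^esub> b) (s \<otimes>\<^bsub>R\<^esub> t)),
       one = fraction R \<one>\<^bsub>R\<^esub> \<one>\<^bsub>R\<^esub>,
       zero = fraction R \<zero>\<^bsub>R\<^esub> \<one>\<^bsub>R\<^esub>,
       add = (\<lambda>F G. \<Union>(a, s) \<in> F. \<Union>(b, t) \<in> G.
                fraction R (a \<otimes>\<^bsub>R\<^esub> t \<oplus>\<^bsub>R\<^esub> b \<otimes>\<^bsub>R\<^esub> s) (s \<otimes>\<^bsub>R\<^esub> t)) \<rparr>"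

context domain
begin

lemma fraction_self: "a \<in> carrier R \<Longrightarrow> s \<in> carrier R - {\<zero>} \<Longrightarrow> (a, s) \<in> fraction R a s"
  by (simp add: fraction_def)

lemma fraction_eq_iff:
  assumes "a \<in> carrier R" "s \<in> carrier R - {\<zero>}" "b \<in> carrier R" "t \<in> carrier R - {\<zero>}"
  shows "fraction R a s = fraction R b t \<longleftrightarrow> a \<otimes> t = b \<otimes> s"
proof
  assume "fraction R a s = fraction R b t"
  with fraction_self[OF assms(3,4)] show "a \<otimes> t = b \<otimes> s"
    by (auto simp: fraction_def)
next
  have sub: "fraction R a s \<subseteq> fraction R b t"
    if "a \<otimes> t = b \<otimes> s" "a \<in> carrier R" "s \<in> carrier R - {\<zero>}" "b \<in> carrier R" "t \<in> carrier R - {\<zero>}"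
    for a s b t
  proof
    fix x assume "x \<in> fraction R a s"
    then obtain c u where x: "x = (c, u)" and c: "c \<in> carrier R" and u: "u \<in> carrier R - {\<zero>}"
      and e: "a \<otimes> u = c \<otimes> s"
      by (auto simp: fraction_def)
    have "s \<otimes> (b \<otimes> u) = (b \<otimes> s) \<otimes> u"
      using that c u by (simp add: m_ac)
    also have "\<dots> = (a \<otimes> u) \<otimes> t"
      using that(2-) c u by (simp add: that(1)[symmetric] m_ac)
    also have "\<dots> = s \<otimes> (c \<otimes> t)"
      using that(2-) c u by (simp add: e m_ac)
    finally have "b \<otimes> u = c \<otimes> t"
      using that c u by (simp add: m_lcancel)
    then show "x \<in> fraction R b t"
      using x c u by (simp add: fraction_def)
  qed
  assume "a \<otimes> t = b \<otimes> s"
  then show "fraction R a s = fraction R b t"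
    using assms by (intro equalityI sub) auto
qed

lemma carrier_fraction_field:
  "carrier (fraction_field R) = {fraction R a s | a s. a \<in> carrier R \<and> s \<in> carrier R - {\<zero>}}"
  by (simp add: fraction_field_def)

lemma prod_nonzero: "s \<in> carrier R - {\<zero>} \<Longrightarrow> t \<in> carrier R - {\<zero>} \<Longrightarrow> s \<otimes> t \<in> carrier R - {\<zero>}"
  using integral by auto

lemma fraction_mult:
  assumes "a \<in> carrier R" "s \<in> carrier R - {\<zero>}" "b \<in> carrier R" "t \<in> carrier R - {\<zero>}"
  shows "fraction R a s \<otimes>\<^bsub>fraction_field R\<^esub> fraction R b t = fraction R (a \<otimes> b) (s \<otimes> t)"
proof -
  have "fraction R (c \<otimes> d) (u \<otimes> v) = fraction R (a \<otimes> b) (s \<otimes> t)"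
    if "(c, u) \<in> fraction R a s" "(d, v) \<in> fraction R b t" for c u d v
  proof -
    from that have e: "a \<otimes> u = c \<otimes> s" "b \<otimes> v = d \<otimes> t"
      and cl: "c \<in> carrier R" "d \<in> carrier R" "u \<in> carrier R - {\<zero>}" "v \<in> carrier R - {\<zero>}"
      by (auto simp: fraction_def)
    have "(c \<otimes> d) \<otimes> (s \<otimes> t) = (c \<otimes> s) \<otimes> (d \<otimes> t)"
      using assms cl by (simp add: m_ac)
    also have "\<dots> = (a \<otimes> b) \<otimes> (u \<otimes> v)"
      using assms cl by (simp add: e[symmetric] m_ac)
    finally show ?thesis
      using assms cl prod_nonzero by (subst fraction_eq_iff) auto
  qed
  then have "fraction R a s \<otimes>\<^bsub>fraction_field R\<^esub> fraction R b t
      = (\<Union>_ \<in> fraction R a s. \<Union>_ \<in> fraction R b t. fraction R (a \<otimes> b) (s \<otimes> t))"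
    by (simp add: fraction_field_def case_prod_beta cong: SUP_cong)
  also have "\<dots> = fraction R (a \<otimes> b) (s \<otimes> t)"
    using fraction_self[OF assms(1,2)] fraction_self[OF assms(3,4)] by (auto simp: UN_constant)
  finally show ?thesis .
qed

lemma fraction_add:
  assumes "a \<in> carrier R" "s \<in> carrier R - {\<zero>}" "b \<in> carrier R" "t \<in> carrier R - {\<zero>}"
  shows "fraction R a s \<oplus>\<^bsub>fraction_field R\<^esub> fraction R b t
           = fraction R (a \<otimes> t \<oplus> b \<otimes> s) (s \<otimes> t)"
proof -
  have "fraction R (c \<otimes> v \<oplus> d \<otimes> u) (u \<otimes> v) = fraction R (a \<otimes> t \<oplus> b \<otimes> s) (s \<otimes> t)"
    if "(c, u) \<in> fraction R a s" "(d, v) \<in> fraction R b t" for c u d v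
  proof -
    from that have e: "a \<otimes> u = c \<otimes> s" "b \<otimes> v = d \<otimes> t"
      and cl: "c \<in> carrier R" "d \<in> carrier R" "u \<in> carrier R - {\<zero>}" "v \<in> carrier R - {\<zero>}"
      by (auto simp: fraction_def)
    have "(c \<otimes> v \<oplus> d \<otimes> u) \<otimes> (s \<otimes> t) = (c \<otimes> s) \<otimes> (v \<otimes> t) \<oplus> (d \<otimes> t) \<otimes> (u \<otimes> s)"
      using assms cl by (simp add: l_distr r_distr m_ac)
    also have "\<dots> = (a \<otimes> t \<oplus> b \<otimes> s) \<otimes> (u \<otimes> v)"
      unfolding e[symmetric] using assms cl by (simp add: l_distr r_distr m_ac)
    finally show ?thesis
      using assms cl prod_nonzero by (subst fraction_eq_iff) auto
  qed
  then have "fraction R a s \<oplus>\<^bsub>fraction_field R\<^esub> fraction R b t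
      = (\<Union>_ \<in> fraction R a s. \<Union>_ \<in> fraction R b t. fraction R (a \<otimes> t \<oplus> b \<otimes> s) (s \<otimes> t))"
    by (simp add: fraction_field_def case_prod_beta cong: SUP_cong)
  also have "\<dots> = fraction R (a \<otimes> t \<oplus> b \<otimes> s) (s \<otimes> t)"
    using fraction_self[OF assms(1,2)] fraction_self[OF assms(3,4)] by (auto simp: UN_constant)
  finally show ?thesis .
qed

lemma fraction_zero: "\<zero>\<^bsub>fraction_field R\<^esub> = fraction R \<zero> \<one>"
  and fraction_one: "\<one>\<^bsub>fraction_field R\<^esub> = fraction R \<one> \<one>"
  by (simp_all add: fraction_field_def)

lemma fraction_field_is_field: "field (fraction_field R)"
proof -
  have pn: "s \<otimes> t \<noteq> \<zero>" if "s \<in> carrier R" "s \<noteq> \<zero>" "t \<in> carrier R" "t \<noteq> \<zero>" for s t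
    using integral that by blast
  have car: "fraction R a s \<in> carrier (fraction_field R)"
    if "a \<in> carrier R" "s \<in> carrier R" "s \<noteq> \<zero>" for a s
    using that by (auto simp: carrier_fraction_field)
  have "cring (fraction_field R)"
  proof (rule cringI)
    show "abelian_group (fraction_field R)"
    proof (rule abelian_groupI)
      fix x assume "x \<in> carrier (fraction_field R)"
      then obtain a s where x: "x = fraction R a s" "a \<in> carrier R" "s \<in> carrier R - {\<zero>}"
        by (auto simp: carrier_fraction_field)
      have "fraction R (\<ominus> a) s \<oplus>\<^bsub>fraction_field R\<^esub> x = \<zero>\<^bsub>fraction_field R\<^esub>"
        using x pn by (simp add: fraction_add fraction_zero fraction_eq_iff l_minus l_neg)
      then show "\<exists>y\<in>carrier (fraction_field R). y \<oplus>\<^bsub>fraction_field R\<^esub> x = \<zero>\<^bsub>fraction_field R\<^esub>"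
        by (rule bexI) (use x car in simp)
      show "\<zero>\<^bsub>fraction_field R\<^esub> \<oplus>\<^bsub>fraction_field R\<^esub> x = x"
        using x pn by (simp add: fraction_add fraction_zero)
      fix y assume "y \<in> carrier (fraction_field R)"
      then obtain b t where y: "y = fraction R b t" "b \<in> carrier R" "t \<in> carrier R - {\<zero>}"
        by (auto simp: carrier_fraction_field)
      show "x \<oplus>\<^bsub>fraction_field R\<^esub> y \<in> carrier (fraction_field R)"
        using x y pn by (simp add: fraction_add car)
      show "x \<oplus>\<^bsub>fraction_field R\<^esub> y = y \<oplus>\<^bsub>fraction_field R\<^esub> x"
        using x y pn by (simp add: fraction_add m_comm a_comm)
      fix z assume "z \<in> carrier (fraction_field R)"
      then obtain c u where z: "z = fraction R c u" "c \<in> carrier R" "u \<in> carrier R - {\<zero>}"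
        by (auto simp: carrier_fraction_field)
      show "x \<oplus>\<^bsub>fraction_field R\<^esub> y \<oplus>\<^bsub>fraction_field R\<^esub> z
          = x \<oplus>\<^bsub>fraction_field R\<^esub> (y \<oplus>\<^bsub>fraction_field R\<^esub> z)"
        using x y z pn by (simp add: fraction_add l_distr r_distr m_ac a_ac)
    qed (simp add: fraction_zero car)
    show "Group.comm_monoid (fraction_field R)"
    proof (rule comm_monoidI)
      fix x assume "x \<in> carrier (fraction_field R)"
      then obtain a s where x: "x = fraction R a s" "a \<in> carrier R" "s \<in> carrier R - {\<zero>}"
        by (auto simp: carrier_fraction_field)
      show "\<one>\<^bsub>fraction_field R\<^esub> \<otimes>\<^bsub>fraction_field R\<^esub> x = x"
        using x by (simp add: fraction_mult fraction_one)
      fix y assume "y \<in> carrier (fraction_field R)"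
      then obtain b t where y: "y = fraction R b t" "b \<in> carrier R" "t \<in> carrier R - {\<zero>}"
        by (auto simp: carrier_fraction_field)
      show "x \<otimes>\<^bsub>fraction_field R\<^esub> y \<in> carrier (fraction_field R)"
        using x y pn by (simp add: fraction_mult car)
      show "x \<otimes>\<^bsub>fraction_field R\<^esub> y = y \<otimes>\<^bsub>fraction_field R\<^esub> x"
        using x y by (simp add: fraction_mult m_comm)
      fix z assume "z \<in> carrier (fraction_field R)"
      then obtain c u where z: "z = fraction R c u" "c \<in> carrier R" "u \<in> carrier R - {\<zero>}"
        by (auto simp: carrier_fraction_field)
      show "x \<otimes>\<^bsub>fraction_field R\<^esub> y \<otimes>\<^bsub>fraction_field R\<^esub> z
          = x \<otimes>\<^bsub>fraction_field R\<^esub> (y \<otimes>\<^bsub>fraction_field R\<^esub> z)"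
        using x y z pn by (simp add: fraction_mult m_ac)
    qed (simp add: fraction_one car)
  next
    fix x y z assume "x \<in> carrier (fraction_field R)" "y \<in> carrier (fraction_field R)"
      "z \<in> carrier (fraction_field R)"
    then obtain a s b t c u where x: "x = fraction R a s" "a \<in> carrier R" "s \<in> carrier R - {\<zero>}"
      and y: "y = fraction R b t" "b \<in> carrier R" "t \<in> carrier R - {\<zero>}"
      and z: "z = fraction R c u" "c \<in> carrier R" "u \<in> carrier R - {\<zero>}"
      unfolding carrier_fraction_field by blast
    show "(x \<oplus>\<^bsub>fraction_field R\<^esub> y) \<otimes>\<^bsub>fraction_field R\<^esub> z
        = x \<otimes>\<^bsub>fraction_field R\<^esub> z \<oplus>\<^bsub>fraction_field R\<^esub> y \<otimes>\<^bsub>fraction_field R\<^esub> z"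
      using x y z pn
      by (simp add: fraction_mult fraction_add fraction_eq_iff l_distr r_distr m_ac)
  qed
  then interpret K: cring "fraction_field R" .
  show ?thesis
  proof (rule K.cring_fieldI2)
    show "\<zero>\<^bsub>fraction_field R\<^esub> \<noteq> \<one>\<^bsub>fraction_field R\<^esub>"
      by (simp add: fraction_zero fraction_one fraction_eq_iff)
    fix x assume "x \<in> carrier (fraction_field R)" "x \<noteq> \<zero>\<^bsub>fraction_field R\<^esub>"
    then obtain a s where x: "x = fraction R a s" "a \<in> carrier R" "s \<in> carrier R - {\<zero>}"
      and nz: "fraction R a s \<noteq> fraction R \<zero> \<one>"
      by (auto simp: carrier_fraction_field fraction_zero)
    have a: "a \<in> carrier R - {\<zero>}"
      using x nz by (simp add: fraction_eq_iff)
    have "x \<otimes>\<^bsub>fraction_field R\<^esub> fraction R s a = \<one>\<^bsub>fraction_field R\<^esub>"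
      using x a pn by (simp add: fraction_mult fraction_one fraction_eq_iff m_comm)
    moreover have "fraction R s a \<in> carrier (fraction_field R)"
      using x a car by simp
    ultimately show "\<exists>b\<in>carrier (fraction_field R). x \<otimes>\<^bsub>fraction_field R\<^esub> b = \<one>\<^bsub>fraction_field R\<^esub>"
      by blast
  qed
qed

end

text \<open>Polynomials are coefficient lists with the leading coefficient first.\<close>

definition integral_over :: "('a, 'b) ring_scheme \<Rightarrow> 'a set \<Rightarrow> 'a \<Rightarrow> bool" where
  "integral_over K S x \<longleftrightarrow>
     (\<exists>p. p \<noteq> [] \<and> polynomial\<^bsub>K\<^esub> S p \<and> lead_coeff p = \<one>\<^bsub>K\<^esub> \<and> ring.eval K p x = \<zero>\<^bsub>K\<^esub>)"

definition integrally_closed :: "('a, 'b) ring_scheme \<Rightarrow> bool" where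
  "integrally_closed R \<longleftrightarrow>
     (let S = (\<lambda>r. fraction R r \<one>\<^bsub>R\<^esub>) ` carrier R
      in \<forall>x \<in> carrier (fraction_field R). integral_over (fraction_field R) S x \<longrightarrow> x \<in> S)"

text \<open>
  A Noetherian integrally closed domain in which nonzero prime ideals are maximal.
  Fields are included.
\<close>

locale dedekind_domain = noetherian_domain +
  assumes integrally_closed: "integrally_closed R"
    and nonzero_prime_maximal: "\<And>P. primeideal P R \<Longrightarrow> P \<noteq> {\<zero>} \<Longrightarrow> maximalideal P R"


section \<open>Unitary Cayley graphs\<close>

definition unitary_cayley_graph :: "('a, 'b) ring_scheme \<Rightarrow> 'a pair_pre_digraph" where
  "unitary_cayley_graph A =
     \<lparr> pverts = carrier A,
       parcs = {(x, y). x \<in> carrier A \<and> y \<in> carrier A \<and> x \<ominus>\<^bsub>A\<^esub> y \<in> Units A} \<rparr>"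

text \<open>
  Undirected graphs are represented by symmetric digraphs, so connected components are
  strongly connected components.
\<close>

lemma (in ring) unitary_cayley_graph_sym: "pair_sym_digraph (unitary_cayley_graph R)"
proof
  have "y \<ominus> x \<in> Units R" if "x \<in> carrier R" "y \<in> carrier R" "x \<ominus> y \<in> Units R" for x y
  proof -
    have "y \<ominus> x = (\<ominus> \<one>) \<otimes> (x \<ominus> y)"
      using that by (simp add: a_minus_def l_minus minus_add r_distr a_comm)
    moreover have "\<ominus> \<one> \<in> Units R"
      by (auto simp: Units_def l_minus r_minus intro!: bexI[of _ "\<ominus> \<one>"])
    ultimately show ?thesis
      using that by simp
  qed
  then show "symmetric (with_proj (unitary_cayley_graph R))"
    by (auto simp: symmetric_def unitary_cayley_graph_def intro!: symI)
qed (auto simp: unitary_cayley_graph_def)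

lemma (in ring) unitary_cayley_graph_loopfree:
  "\<one> \<noteq> \<zero> \<Longrightarrow> x \<in> carrier R \<Longrightarrow> (x, x) \<notin> parcs (unitary_cayley_graph R)"
  by (auto simp: unitary_cayley_graph_def a_minus_def r_neg Units_def)

text \<open>The supremum of the distances, where every arc has length 1.\<close>

definition graph_diameter :: "('v, 'e) pre_digraph \<Rightarrow> ereal" where
  "graph_diameter C = (SUP u \<in> verts C. SUP v \<in> verts C. wf_digraph.\<mu> C (\<lambda>_. 1) u v)"

end

theory Submission
  imports Defs
begin

text \<open>
  An element of \<open>R/I\<close> is a unit iff it lies outside every maximal ideal \<open>M \<supseteq> I\<close>. Modulo an \<open>M\<close> of index 2
  two nonmembers are congruent, so along a walk the difference of the end points lies in \<open>M\<close> iff the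
  length is even; this bounds distances from below by parity. Conversely, the Chinese remainder theorem
  writes any \<open>d\<close> lying in all \<open>M\<close> of index 2 as a difference of two units: modulo the other \<open>M\<close> there are at
  least three residues, hence one avoiding both \<open>0\<close> and \<open>d\<close>. So vertices whose difference lies in all \<open>M\<close> of
  index 2 have distance at most 2, and those whose difference lies in none have distance 1 or 3, the latter
  occurring iff some \<open>M\<close> has index other than 2.

  The Dedekind hypothesis is used twice: a prime of index 2 containing \<open>J\<close> would divide \<open>J\<close>, so the \<open>M\<close> of
  index 2 are exactly the \<open>P\<^sub>i\<close>; and \<open>P\<^sub>i\<^sup>2 \<noteq> P\<^sub>i\<close>, so \<open>I\<close> is properly contained in the intersection
  of the \<open>P\<^sub>i\<close> when some exponent exceeds 1.
\<close>

section \<open>Diameter of a component\<close>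

text \<open>In a symmetric digraph the vertices reachable from \<open>u\<close> induce a strong
  component, and distinct strong components share no vertex.\<close>

lemma (in sym_digraph) scc_conv_reachable:
  assumes "C \<in> sccs" "u \<in> verts C"
  shows "C = G \<restriction> {v. u \<rightarrow>\<^sup>* v}"
proof (rule ccontr)
  assume ne: "C \<noteq> G \<restriction> {v. u \<rightarrow>\<^sup>* v}"
  have u: "u \<in> verts G"
    using assms by (auto simp: sccs_def)
  with ne have "verts C \<inter> {v. u \<rightarrow>\<^sup>* v} = {}"
    using scc_disj[OF assms(1) induce_reachable_is_in_sccs[OF u]] by simp
  then show False using assms(2) u by auto
qed

text \<open>Both bounds concern walks of the whole graph, so that no component has to be known
  explicitly; \<open>lower\<close> ranges over all vertices because any of them may be the one
  picked from \<open>C\<close>.\<close>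

lemma (in sym_digraph) graph_diameter_scc:
  fixes n :: nat
  assumes C: "C \<in> sccs"
    and upper: "\<And>u v. u \<rightarrow>\<^sup>* v \<Longrightarrow> \<exists>p. awalk u p v \<and> length p \<le> n"
    and lower: "\<And>u. u \<in> verts G \<Longrightarrow> \<exists>v. u \<rightarrow>\<^sup>* v \<and> (\<forall>p. awalk u p v \<longrightarrow> n \<le> length p)"
  shows "graph_diameter C = n"
proof -
  have ind: "induced_subgraph C G" and sc: "strongly_connected C"
    using C by (auto simp: sccs_def)
  interpret C: wf_digraph C
    using ind by (rule wf_digraphI_induced)
  have cost: "C.awalk_cost (\<lambda>_. 1) p = length p" for p
    by (induction p) auto
  have verts: "v \<in> verts C \<longleftrightarrow> u \<rightarrow>\<^sup>* v" if "u \<in> verts C" for u v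
    by (subst scc_conv_reachable[OF C that]) simp
  have sub: "subgraph C G" using ind by auto
  have awalk: "C.awalk u p v" if "awalk u p v" "u \<in> verts C" for u p v
  proof -
    \<comment> \<open>A walk starting in \<open>C\<close> never leaves it, since every vertex on it
      is reachable from \<open>u\<close>.\<close>
    have "set (awalk_verts u p) \<subseteq> {w. u \<rightarrow>\<^sup>* w}"
      using that(1) awalk_verts_reachable_from by blast
    with that show ?thesis
      by (subst scc_conv_reachable[OF C that(2)]) (rule awalk_induce)
  qed
  have mu: "C.\<mu> (\<lambda>_. 1) u v \<le> n" if u: "u \<in> verts C" and v: "v \<in> verts C" for u v
  proof -
    obtain p where p: "awalk u p v" "length p \<le> n"
      using upper verts[OF u] v by blast
    have "C.\<mu> (\<lambda>_. 1) u v \<le> C.awalk_cost (\<lambda>_. 1) p"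
      by (intro C.min_cost_le_walk_cost awalk p u)
    also have "\<dots> \<le> n" using p cost by simp
    finally show ?thesis .
  qed
  obtain u where u: "u \<in> verts C"
    using sc by (auto simp: strongly_connected_def)
  then obtain v where v: "u \<rightarrow>\<^sup>* v" and n: "\<And>p. awalk u p v \<Longrightarrow> n \<le> length p"
    using lower sub by blast
  have "n \<le> C.\<mu> (\<lambda>_. 1) u v"
    unfolding C.\<mu>_def cost
    by (intro INF_greatest) (use subgraph_awalk_imp_awalk[OF _ sub] n in auto)
  also have "\<dots> \<le> graph_diameter C"
    unfolding graph_diameter_def using u v verts[OF u] by (meson SUP_upper2 order_refl)
  finally have "n \<le> graph_diameter C" .
  moreover have "graph_diameter C \<le> n"
    unfolding graph_diameter_def by (intro SUP_least mu)
  ultimately show ?thesis by (rule antisym[rotated])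
qed

section \<open>Maximal ideals\<close>

lemma (in ideal) carrier_Quot: "carrier (R Quot I) = (+>) I ` carrier R"
  by (auto simp: FactRing_simps)

lemma (in ideal) rcos_eq_self_iff:
  assumes "x \<in> carrier R" shows "I +> x = I \<longleftrightarrow> x \<in> I"
  using assms rcos_const_imp_mem a_rcos_zero[OF is_ideal] by blast

lemma (in ideal) self_in_carrier_Quot: "I \<in> carrier (R Quot I)"
  unfolding carrier_Quot using rcos_eq_self_iff[of \<zero>] by force

text \<open>\<open>I\<close> and \<open>I +> x\<close> exhaust the two cosets, so
  \<open>I +> y\<close>, being different from \<open>I\<close>, must be
  \<open>I +> x\<close>.\<close>

lemma (in ideal) index_two_minus_mem:
  assumes "card (carrier (R Quot I)) = 2" "x \<in> carrier R" "y \<in> carrier R" "x \<notin> I" "y \<notin> I"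
  shows "x \<ominus> y \<in> I"
proof -
  have ne: "I +> x \<noteq> I" "I +> y \<noteq> I"
    using assms rcos_eq_self_iff by auto
  have "finite (carrier (R Quot I))"
    using assms(1) card.infinite by fastforce
  moreover have "{I, I +> x} \<subseteq> carrier (R Quot I)"
    using self_in_carrier_Quot assms(2) by (auto simp: carrier_Quot)
  moreover have "card {I, I +> x} = card (carrier (R Quot I))"
    using ne assms(1) by auto
  ultimately have "{I, I +> x} = carrier (R Quot I)"
    by (rule card_subset_eq)
  moreover have "I +> y \<in> carrier (R Quot I)"
    using assms(3) by (auto simp: carrier_Quot)
  ultimately have "I +> x = I +> y"
    using ne by auto
  then show ?thesis
    using quotient_eq_iff_same_a_r_cos[OF is_ideal assms(2,3)] by simp
qed

lemma (in primeideal) index_two_maximal: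
  assumes "card (carrier (R Quot I)) = 2"
  shows "maximalideal I R"
proof (rule maximalidealI[OF is_ideal])
  show "carrier R \<noteq> I" by (rule I_notcarr)
next
  fix J assume J: "ideal J R" "I \<subseteq> J" "J \<subseteq> carrier R"
  interpret J: ideal J R by fact
  show "J = I \<or> J = carrier R"
  proof (rule disjCI)
    assume "J \<noteq> carrier R"
    then have one: "\<one> \<notin> J" using J.one_imp_carrier by blast
    have "x \<in> I" if "x \<in> J" for x
    proof (rule ccontr)
      assume "x \<notin> I"
      \<comment> \<open>Both 1 and \<open>x\<close> lie outside \<open>I\<close>, so index two puts
        their difference in \<open>I\<close>, hence in \<open>J\<close>, and \<open>J\<close> would
        contain 1.\<close>
      then have "\<one> \<ominus> x \<in> J"
        using index_two_minus_mem[OF assms one_closed, of x] one J that by auto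
      then have "(\<one> \<ominus> x) \<oplus> x \<in> J"
        using that by (rule J.a_closed)
      moreover have "(\<one> \<ominus> x) \<oplus> x = \<one>"
        using J.Icarr[OF that] by algebra
      ultimately show False using one by simp
    qed
    with J(2) show "J = I" by blast
  qed
qed

text \<open>The residue of \<open>z\<close> has to avoid those of 0 and \<open>d\<close>. For
  \<open>d\<close> in \<open>I\<close> the choice 1 works; otherwise failure leaves only the cosets
  of 0 and \<open>d\<close>, and the index is 2. An infinite quotient has \<open>card\<close> 0 and
  is thus covered.\<close>

lemma (in maximalideal) exists_nonmember_shift:
  assumes "d \<in> I \<or> card (carrier (R Quot I)) \<noteq> 2" "d \<in> carrier R"
  shows "\<exists>z \<in> carrier R. z \<notin> I \<and> z \<ominus> d \<notin> I"
proof (cases "d \<in> I")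
  case True
  have one: "\<one> \<notin> I"
    using I_notcarr one_imp_carrier by blast
  moreover have "\<one> \<ominus> d \<notin> I"
  proof
    assume "\<one> \<ominus> d \<in> I"
    then have "(\<one> \<ominus> d) \<oplus> d \<in> I" using True by (rule additive_subgroup.a_closed[OF is_additive_subgroup])
    moreover have "(\<one> \<ominus> d) \<oplus> d = \<one>"
      using assms(2) by algebra
    ultimately show False using one by simp
  qed
  ultimately show ?thesis by blast
next
  case False
  show ?thesis
  proof (rule ccontr)
    assume "\<not> ?thesis"
    then have "I +> z = I \<or> I +> z = I +> d" if "z \<in> carrier R" for z
      using that assms(2) rcos_eq_self_iff quotient_eq_iff_same_a_r_cos[OF is_ideal] by blast
    then have "carrier (R Quot I) = {I, I +> d}"
      using self_in_carrier_Quot assms(2) by (auto simp: carrier_Quot)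
    moreover have "I +> d \<noteq> I"
      using False assms(2) rcos_eq_self_iff by auto
    ultimately show False using assms(1) False by auto
  qed
qed

section \<open>Comaximality and the Chinese remainder theorem\<close>

lemma (in cring) mem_add_cgenideal:
  assumes "ideal I R" "a \<in> carrier R" "x \<in> carrier R"
  shows "x \<in> I <+> PIdl a \<longleftrightarrow> (\<exists>t \<in> carrier R. x \<ominus> t \<otimes> a \<in> I)"
proof
  interpret ideal I R by fact
  assume "x \<in> I <+> PIdl a"
  then obtain i t where it: "i \<in> I" "t \<in> carrier R" "x = i \<oplus> t \<otimes> a"
    by (auto simp: set_add_def' cgenideal_def)
  then have "x \<ominus> t \<otimes> a = i"
    using Icarr[OF it(1)] assms by algebra
  then show "\<exists>t \<in> carrier R. x \<ominus> t \<otimes> a \<in> I"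
    using it(1,2) by auto
next
  assume "\<exists>t \<in> carrier R. x \<ominus> t \<otimes> a \<in> I"
  then obtain t where t: "t \<in> carrier R" "x \<ominus> t \<otimes> a \<in> I" by blast
  have "x = (x \<ominus> t \<otimes> a) \<oplus> t \<otimes> a"
    using assms t(1) by algebra
  then show "x \<in> I <+> PIdl a"
    using t by (auto simp: set_add_def' cgenideal_def)
qed

lemma (in cring) ideal_subset_add_cgenideal:
  assumes "ideal I R" "a \<in> carrier R"
  shows "I \<subseteq> I <+> PIdl a" "a \<in> I <+> PIdl a"
proof -
  interpret ideal I R by fact
  show "I \<subseteq> I <+> PIdl a"
  proof
    fix i assume i: "i \<in> I"
    have "i \<ominus> \<zero> \<otimes> a = i" using Icarr[OF i] assms(2) by algebra
    then show "i \<in> I <+> PIdl a"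
      using i Icarr[OF i] by (subst mem_add_cgenideal[OF assms]) (auto intro: bexI[of _ \<zero>])
  qed
  have "a \<ominus> \<one> \<otimes> a = \<zero>" using assms(2) by algebra
  then show "a \<in> I <+> PIdl a"
    by (subst mem_add_cgenideal[OF assms assms(2)]) (auto intro: bexI[of _ \<one>])
qed

text \<open>The ideal generated by \<open>M\<close> and \<open>a\<close> properly contains
  \<open>M\<close>, so it contains 1; in other words, \<open>a\<close> is invertible in the residue
  field.\<close>

lemma (in cring) maximalideal_inverse:
  assumes "maximalideal M R" "a \<in> carrier R" "a \<notin> M"
  shows "\<exists>t \<in> carrier R. \<one> \<ominus> t \<otimes> a \<in> M"
proof -
  interpret maximalideal M R by fact
  have id: "ideal (M <+> PIdl a) R"
    by (intro add_ideals is_ideal cgenideal_ideal assms)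
  then have "M <+> PIdl a = M \<or> M <+> PIdl a = carrier R"
    by (intro I_maximal ideal_subset_add_cgenideal is_ideal assms)
       (auto dest: ideal.Icarr)
  then have "\<one> \<in> M <+> PIdl a"
    using ideal_subset_add_cgenideal(2)[OF is_ideal assms(2)] assms(3) by auto
  then show ?thesis
    using mem_add_cgenideal[OF is_ideal assms(2)] by simp
qed

lemma (in cring) maximalideal_subset_eq:
  assumes "maximalideal M R" "maximalideal N R" "M \<subseteq> N"
  shows "M = N"
  using maximalideal.I_maximal[OF assms(1), of N] assms maximalideal.I_notcarr
    maximalideal.axioms(1) ideal.Icarr by (metis subsetI)

text \<open>A product of elements of \<open>M - N\<close>, one for each \<open>M\<close> in
  \<open>F\<close>, lies in every \<open>M\<close> and stays outside \<open>N\<close> because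
  \<open>N\<close> is prime.\<close>

lemma (in cring) maximalideals_prime_avoidance:
  assumes "finite F" "\<And>M. M \<in> F \<Longrightarrow> maximalideal M R" "maximalideal N R" "N \<notin> F"
  shows "\<exists>e \<in> carrier R. (\<forall>M \<in> F. e \<in> M) \<and> e \<notin> N"
  using assms(1,2,4)
proof (induction F)
  case empty
  then show ?case
    using maximalideal.I_notcarr[OF assms(3)] ideal.one_imp_carrier[OF maximalideal.axioms(1)[OF assms(3)]]
    by (intro bexI[of _ \<one>]) auto
next
  case (insert M F)
  then obtain e where e: "e \<in> carrier R" "\<forall>M \<in> F. e \<in> M" "e \<notin> N" by auto
  have M: "ideal M R" "maximalideal M R"
    using insert.prems(1) maximalideal.axioms(1) by auto
  with insert.prems(2) obtain f where f: "f \<in> M" "f \<notin> N"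
    using maximalideal_subset_eq[OF M(2) assms(3)] by auto
  then have fc: "f \<in> carrier R" using ideal.Icarr[OF M(1)] by auto
  have "e \<otimes> f \<notin> N"
    using primeideal.I_prime[OF maximalideal_prime[OF assms(3)] e(1) fc] e f by auto
  moreover have "e \<otimes> f \<in> M"
    using f e ideal.I_l_closed[OF M(1)] by auto
  moreover have "e \<otimes> f \<in> M'" if "M' \<in> F" for M'
    using ideal.I_r_closed[OF maximalideal.axioms(1), of M' R e f] insert.prems(1) e fc that by auto
  ultimately show ?case
    using e fc by (intro bexI[of _ "e \<otimes> f"]) auto
qed

lemma (in cring) chinese_remainder_maximalideals:
  assumes "finite F" "\<And>M. M \<in> F \<Longrightarrow> maximalideal M R" "\<And>M. M \<in> F \<Longrightarrow> c M \<in> carrier R"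
  shows "\<exists>z \<in> carrier R. \<forall>M \<in> F. z \<ominus> c M \<in> M"
  using assms
proof (induction F)
  case empty
  then show ?case by auto
next
  case (insert N F)
  then obtain z where z: "z \<in> carrier R" "\<forall>M \<in> F. z \<ominus> c M \<in> M" by auto
  have N: "maximalideal N R" "ideal N R" "c N \<in> carrier R"
    using insert.prems maximalideal.axioms(1) by auto
  obtain e where e: "e \<in> carrier R" "\<forall>M \<in> F. e \<in> M" "e \<notin> N"
    using maximalideals_prime_avoidance[of F N] insert by auto
  obtain t where t: "t \<in> carrier R" "\<one> \<ominus> t \<otimes> e \<in> N"
    using maximalideal_inverse[OF N(1) e(1,3)] by auto
  \<comment> \<open>The correction is a multiple of \<open>e\<close>, hence invisible modulo the
    ideals in \<open>F\<close>; modulo \<open>N\<close>, where \<open>t \<otimes> e\<close> is 1, it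
    replaces \<open>z\<close> by \<open>c N\<close>.\<close>
  define w where "w = z \<oplus> (t \<otimes> (c N \<ominus> z)) \<otimes> e"
  have wc: "w \<in> carrier R"
    unfolding w_def using z t e N by simp
  have "w \<ominus> c N = (z \<ominus> c N) \<otimes> (\<one> \<ominus> t \<otimes> e)"
    unfolding w_def using z(1) t(1) e(1) N(3) by algebra
  then have "w \<ominus> c N \<in> N"
    using t z N by (simp add: ideal.I_l_closed)
  moreover have "w \<ominus> c M \<in> M" if M: "M \<in> F" for M
  proof -
    interpret M: ideal M R using insert.prems(1) M maximalideal.axioms(1) by blast
    have "(z \<ominus> c M) \<oplus> (t \<otimes> (c N \<ominus> z)) \<otimes> e \<in> M"
      using M e z t N by (intro M.a_closed M.I_l_closed) auto
    moreover have "w \<ominus> c M = (z \<ominus> c M) \<oplus> (t \<otimes> (c N \<ominus> z)) \<otimes> e"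
      unfolding w_def using z(1) t(1) e(1) N(3) insert.prems(2)[of M] M by (simp add: a_minus_def a_ac)
    ultimately show ?thesis by simp
  qed
  ultimately show ?case using wc by blast
qed

section \<open>Maximal elements in Noetherian rings\<close>

lemma (in noetherian_ring) exists_maximal_in_ideals:
  assumes ne: "F \<noteq> {}" and id: "\<And>I. I \<in> F \<Longrightarrow> ideal I R"
  shows "\<exists>M \<in> F. \<forall>N \<in> F. M \<subseteq> N \<longrightarrow> N = M"
proof -
  have "\<Union> C \<in> F" if C: "C \<noteq> {}" "subset.chain F C" for C
  proof -
    have sub: "C \<subseteq> F" and ch: "\<forall>I \<in> C. \<forall>J \<in> C. I \<subseteq> J \<or> J \<subseteq> I"
      using C(2) subset_chain_def[of F C] by fast+
    have "C \<subseteq> {I. ideal I R}"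
      using sub id by fast
    with ch have "subset.chain {I. ideal I R} C" 
      by (simp only: subset_chain_def)
    \<comment> \<open>In a Noetherian ring a nonempty chain of ideals contains its own union, so
      Zorn's lemma applies to any nonempty family of ideals.\<close>
    with C(1) have "\<Union> C \<in> C" by (rule ideal_chain_is_trivial)
    with sub show ?thesis by (rule subsetD)
  qed
  with ne show ?thesis by (rule subset_Zorn_nonempty)
qed
lemma (in noetherian_ring) exists_maximalideal:
  assumes "ideal I R" "I \<noteq> carrier R"
  shows "\<exists>M. maximalideal M R \<and> I \<subseteq> M"
proof -
  define F where "F = {M. ideal M R \<and> I \<subseteq> M \<and> M \<noteq> carrier R}"
  have F: "M \<in> F \<longleftrightarrow> ideal M R \<and> I \<subseteq> M \<and> M \<noteq> carrier R" for M
    by (simp only: F_def mem_Collect_eq)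
  have ne: "F \<noteq> {}" using assms F[of I] by (metis empty_iff order_refl)
  have "\<exists>M \<in> F. \<forall>N \<in> F. M \<subseteq> N \<longrightarrow> N = M"
    by (rule exists_maximal_in_ideals[OF ne]) (simp only: F)
  then obtain M where M: "ideal M R" "I \<subseteq> M" "M \<noteq> carrier R"
    and max: "\<And>N. N \<in> F \<Longrightarrow> M \<subseteq> N \<Longrightarrow> N = M" using F by metis
  have "maximalideal M R"
  proof (rule maximalidealI[OF M(1) M(3)[symmetric]])
    fix N assume N: "ideal N R" "M \<subseteq> N" "N \<subseteq> carrier R"
    have "N = M" if "N \<noteq> carrier R"
      using max[of N] N M(2) that F[of N] by (metis order_trans)
    then show "N = M \<or> N = carrier R" by metis
  qed
  with M(2) show ?thesis by metis
qed

section \<open>Unitary Cayley graphs of finite quotients\<close>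

text \<open>Both sides say that the ideal generated by \<open>I\<close> and \<open>x\<close> is all
  of \<open>R\<close>: an inverse amounts to a relation
  \<open>\<one> \<ominus> t \<otimes> x \<in> I\<close>, and a proper ideal lies in a maximal
  one.\<close>

lemma (in cring) rcos_Units_iff:
  assumes "noetherian_ring R" "ideal I R" "x \<in> carrier R"
  shows "I +> x \<in> Units (R Quot I) \<longleftrightarrow> (\<forall>M. maximalideal M R \<longrightarrow> I \<subseteq> M \<longrightarrow> x \<notin> M)"
proof -
  interpret ideal I R by fact
  interpret Q: ring_hom_cring R "R Quot I" "(+>) I"
    by (rule rcos_ring_hom_cring[OF is_cring])
  have unit: "I +> x \<in> Units (R Quot I) \<longleftrightarrow> (\<exists>t \<in> carrier R. \<one> \<ominus> t \<otimes> x \<in> I)"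
  proof
    assume "I +> x \<in> Units (R Quot I)"
    then obtain Y where Y: "Y \<in> carrier (R Quot I)" "Y \<otimes>\<^bsub>R Quot I\<^esub> (I +> x) = \<one>\<^bsub>R Quot I\<^esub>"
      by (auto simp: Units_def)
    then obtain y where y: "y \<in> carrier R" "Y = I +> y"
      by (auto simp: carrier_Quot)
    with Y have "I +> \<one> = I +> (y \<otimes> x)"
      using assms(3) by simp
    then show "\<exists>t \<in> carrier R. \<one> \<ominus> t \<otimes> x \<in> I"
      using quotient_eq_iff_same_a_r_cos[OF is_ideal, of \<one> "y \<otimes> x"] y assms(3) by auto
  next
    assume "\<exists>t \<in> carrier R. \<one> \<ominus> t \<otimes> x \<in> I"
    then obtain t where t: "t \<in> carrier R" "\<one> \<ominus> t \<otimes> x \<in> I" by auto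
    then have "I +> (t \<otimes> x) = I +> \<one>"
      using quotient_eq_iff_same_a_r_cos[OF is_ideal, of \<one> "t \<otimes> x"] assms(3) by auto
    then have "(I +> t) \<otimes>\<^bsub>R Quot I\<^esub> (I +> x) = \<one>\<^bsub>R Quot I\<^esub>"
      using t(1) assms(3) Q.hom_mult Q.hom_one by metis
    then show "I +> x \<in> Units (R Quot I)"
      using t(1) assms(3) Q.S.m_comm unfolding Units_def by fastforce
  qed
  also have "\<dots> \<longleftrightarrow> \<one> \<in> I <+> PIdl x"
    using mem_add_cgenideal[OF is_ideal assms(3)] by simp
  also have "\<dots> \<longleftrightarrow> (\<forall>M. maximalideal M R \<longrightarrow> I \<subseteq> M \<longrightarrow> x \<notin> M)"
  proof -
    have id: "ideal (I <+> PIdl x) R"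
      by (intro add_ideals is_ideal cgenideal_ideal assms)
    note sub = ideal_subset_add_cgenideal[OF is_ideal assms(3)]
    have one: "\<one> \<notin> M" if "maximalideal M R" for M
      using maximalideal.I_notcarr[OF that] ideal.one_imp_carrier[OF maximalideal.axioms(1)[OF that]] by auto
    moreover have "\<one> \<notin> I <+> PIdl x" if M: "maximalideal M R" "I \<subseteq> M" "x \<in> M" for M
    proof
      interpret M: ideal M R using M(1) by (rule maximalideal.axioms)
      assume "\<one> \<in> I <+> PIdl x"
      then obtain t where t: "t \<in> carrier R" "\<one> \<ominus> t \<otimes> x \<in> M"
        using mem_add_cgenideal[OF is_ideal assms(3)] M(2) by auto
      then have "(\<one> \<ominus> t \<otimes> x) \<oplus> t \<otimes> x \<in> M"
        using M(3) by (intro M.a_closed M.I_l_closed)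
      moreover have "(\<one> \<ominus> t \<otimes> x) \<oplus> t \<otimes> x = \<one>"
        using t(1) assms(3) by algebra
      ultimately show False
        using one[OF M(1)] by simp
    qed
    moreover have "\<exists>M. maximalideal M R \<and> I \<subseteq> M \<and> x \<in> M" if "\<one> \<notin> I <+> PIdl x"
    proof -
      have "I <+> PIdl x \<noteq> carrier R" using that by auto
      then show ?thesis
        using noetherian_ring.exists_maximalideal[OF assms(1) id] sub by blast
    qed
    ultimately show ?thesis by blast
  qed
  finally show ?thesis .
qed

lemma (in cring) unitary_cayley_arc_iff:
  assumes "noetherian_ring R" "ideal I R" "x \<in> carrier R" "y \<in> carrier R"
  shows "(I +> x, I +> y) \<in> parcs (unitary_cayley_graph (R Quot I)) \<longleftrightarrow>
    (\<forall>M. maximalideal M R \<longrightarrow> I \<subseteq> M \<longrightarrow> x \<ominus> y \<notin> M)"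
proof -
  interpret ideal I R by fact
  interpret Q: ring_hom_cring R "R Quot I" "(+>) I"
    by (rule rcos_ring_hom_cring[OF is_cring])
  have "(I +> x) \<ominus>\<^bsub>R Quot I\<^esub> (I +> y) = I +> (x \<ominus> y)"
    using assms by (simp add: a_minus_def)
  then show ?thesis
    using rcos_Units_iff[OF assms(1,2), of "x \<ominus> y"] assms(3,4) Q.hom_closed
    by (simp add: unitary_cayley_graph_def)
qed

text \<open>Ideals containing \<open>I\<close> are determined by their images in \<open>R/I\<close>,
  and a finite quotient has only finitely many subsets.\<close>

lemma (in ring) finite_maximalideals_of_finite_Quot:
  assumes "ideal I R" "finite (carrier (R Quot I))"
  shows "finite {M. maximalideal M R \<and> I \<subseteq> M}"
proof (rule inj_on_finite)
  interpret ideal I R by fact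
  show "inj_on (\<lambda>M. (+>) I ` M) {M. maximalideal M R \<and> I \<subseteq> M}"
  proof (rule inj_onI)
    have *: "M \<subseteq> N" if "ideal M R" "ideal N R" "I \<subseteq> N" "(+>) I ` M \<subseteq> (+>) I ` N" for M N
    proof
      fix x assume x: "x \<in> M"
      with that obtain y where y: "y \<in> N" "I +> x = I +> y" by blast
      have xc: "x \<in> carrier R" "y \<in> carrier R"
        using x y that ideal.Icarr by metis+
      then have "x \<ominus> y \<in> N"
        using quotient_eq_iff_same_a_r_cos[OF is_ideal xc] y that(3) by auto
      then have "(x \<ominus> y) \<oplus> y \<in> N"
        using y(1) that(2) additive_subgroup.a_closed ideal.axioms(1) by metis
      then show "x \<in> N"
        using xc by (simp add: a_minus_def a_assoc l_neg)
    qed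
    fix M N assume "M \<in> {M. maximalideal M R \<and> I \<subseteq> M}" "N \<in> {M. maximalideal M R \<and> I \<subseteq> M}"
      "(+>) I ` M = (+>) I ` N"
    then show "M = N"
      using *[of M N] *[of N M] maximalideal.axioms(1) by (metis (no_types, lifting) mem_Collect_eq order_refl subset_antisym)
  qed
  show "(\<lambda>M. (+>) I ` M) ` {M. maximalideal M R \<and> I \<subseteq> M} \<subseteq> Pow (carrier (R Quot I))"
    using ideal.Icarr[OF maximalideal.axioms(1)] by (force simp: carrier_Quot)
  show "finite (Pow (carrier (R Quot I)))" using assms(2) by simp
qed

text \<open>The setting of all walk arguments: distances are expressed through
  \<open>maximals_over\<close> and \<open>index_two_over\<close>, which the final theorem relates to
  the factorisation of \<open>I\<close>.\<close>

locale noetherian_finite_quotient = cring R + noetherian_ring R + ideal I R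
  for I and R (structure) +
  assumes finite_Quot: "finite (carrier (R Quot I))"
begin

definition maximals_over :: "'a set set" where
  "maximals_over = {M. maximalideal M R \<and> I \<subseteq> M}"

definition index_two_over :: "'a set set" where
  "index_two_over = {M \<in> maximals_over. card (carrier (R Quot M)) = 2}"

abbreviation cayley :: "('a set, 'a set \<times> 'a set) pre_digraph" where
  "cayley \<equiv> with_proj (unitary_cayley_graph (R Quot I))"

lemma maximals_overD:
  assumes "M \<in> maximals_over"
  shows "maximalideal M R" "ideal M R" "I \<subseteq> M" "\<one> \<notin> M"
proof -
  show *: "maximalideal M R" "I \<subseteq> M"
    using assms by (simp_all add: maximals_over_def)
  show "ideal M R" using *(1) by (rule maximalideal.axioms)
  then show "\<one> \<notin> M"
    using maximalideal.I_notcarr[OF *(1)] ideal.one_imp_carrier by metis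
qed

lemma index_two_overD:
  assumes "M \<in> index_two_over"
  shows "M \<in> maximals_over" "card (carrier (R Quot M)) = 2"
  using assms by (simp_all add: index_two_over_def)

lemma finite_maximals_over: "finite maximals_over"
  unfolding maximals_over_def
  by (rule finite_maximalideals_of_finite_Quot[OF is_ideal finite_Quot])

lemma mem_cong:
  assumes "ideal M R" "x \<in> carrier R" "y \<in> carrier R" "x \<ominus> y \<in> M"
  shows "x \<in> M \<longleftrightarrow> y \<in> M"
proof -
  interpret M: ideal M R by fact
  have "y = x \<oplus> \<ominus> (x \<ominus> y)" "x = (x \<ominus> y) \<oplus> y"
    using assms(2,3) by algebra+
  then show ?thesis
    using M.a_closed M.a_inv_closed assms(4) by metis
qed

lemma minus_cancel_right:
  assumes "x \<in> carrier R" "y \<in> carrier R" "z \<in> carrier R"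
  shows "(x \<ominus> z) \<ominus> (y \<ominus> z) = x \<ominus> y"
  using assms by algebra

lemma minus_minus_self:
  assumes "x \<in> carrier R" "d \<in> carrier R"
  shows "x \<ominus> (x \<ominus> d) = d"
  using assms by algebra

text \<open>Makes \<open>d\<close> the difference of \<open>z\<close> and
  \<open>z \<ominus> d\<close>, both units modulo \<open>I\<close>. A suitable residue exists modulo
  each maximal ideal by itself, and the Chinese remainder theorem glues these finitely many
  choices.\<close>

lemma exists_sum_of_units:
  assumes d: "d \<in> carrier R" "\<And>M. M \<in> index_two_over \<Longrightarrow> d \<in> M"
  shows "\<exists>z \<in> carrier R. \<forall>M \<in> maximals_over. z \<notin> M \<and> z \<ominus> d \<notin> M"
proof -
  have "\<exists>c \<in> carrier R. c \<notin> M \<and> c \<ominus> d \<notin> M" if M: "M \<in> maximals_over" for M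
  proof -
    have "d \<in> M \<or> card (carrier (R Quot M)) \<noteq> 2"
      using d(2)[of M] M by (cases "card (carrier (R Quot M)) = 2") (simp_all add: index_two_over_def)
    then show ?thesis
      by (rule maximalideal.exists_nonmember_shift[OF maximals_overD(1)[OF M] _ d(1)])
  qed
  then obtain c where c: "\<And>M. M \<in> maximals_over \<Longrightarrow> c M \<in> carrier R \<and> c M \<notin> M \<and> c M \<ominus> d \<notin> M"
    by metis
  obtain z where z: "z \<in> carrier R" "\<forall>M \<in> maximals_over. z \<ominus> c M \<in> M"
    using chinese_remainder_maximalideals[OF finite_maximals_over, of c] maximals_overD(1) c by metis
  have "z \<notin> M \<and> z \<ominus> d \<notin> M" if M: "M \<in> maximals_over" for M
  proof -
    note id = maximals_overD(2)[OF M]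
    have "(z \<ominus> d) \<ominus> (c M \<ominus> d) \<in> M"
      using minus_cancel_right z c[OF M] d(1) M by simp
    then show ?thesis
      using mem_cong[OF id z(1), of "c M"] mem_cong[OF id, of "z \<ominus> d" "c M \<ominus> d"] z c[OF M] d(1) M
      by simp
  qed
  with z(1) show ?thesis by metis
qed

section \<open>Walks and parity\<close>

lemma sym_digraph_cayley: "sym_digraph cayley"
proof -
  interpret P: pair_sym_digraph "unitary_cayley_graph (R Quot I)"
    using quotient_is_ring by (rule ring.unitary_cayley_graph_sym)
  show ?thesis by unfold_locales
qed

sublocale G: sym_digraph cayley
  by (rule sym_digraph_cayley)

lemma verts_cayley: "verts cayley = (+>) I ` carrier R"
  by (simp add: unitary_cayley_graph_def carrier_Quot)

lemma arc_iff:
  assumes "x \<in> carrier R" "y \<in> carrier R"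
  shows "(I +> x, I +> y) \<in> arcs cayley \<longleftrightarrow> (\<forall>M \<in> maximals_over. x \<ominus> y \<notin> M)"
  using unitary_cayley_arc_iff[OF noetherian_ring_axioms is_ideal assms]
  by (simp add: maximals_over_def imp_conjL)

lemma rcos_vert: "x \<in> carrier R \<Longrightarrow> I +> x \<in> verts cayley"
  unfolding verts_cayley by simp

lemma awalk_arc:
  assumes "x \<in> carrier R" "y \<in> carrier R" "\<And>M. M \<in> maximals_over \<Longrightarrow> x \<ominus> y \<notin> M"
  shows "G.awalk (I +> x) [(I +> x, I +> y)] (I +> y)"
  using arc_iff[OF assms(1,2)] assms rcos_vert by (simp add: G.awalk_Cons_iff G.awalk_Nil_iff)

lemma exists_awalk_2:
  assumes x: "x \<in> carrier R" and y: "y \<in> carrier R"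
    and xy: "\<And>M. M \<in> index_two_over \<Longrightarrow> x \<ominus> y \<in> M"
  shows "\<exists>p. G.awalk (I +> x) p (I +> y) \<and> length p = 2"
proof -
  obtain z where z: "z \<in> carrier R" "\<forall>M \<in> maximals_over. z \<notin> M \<and> z \<ominus> (x \<ominus> y) \<notin> M"
    using exists_sum_of_units[OF minus_closed[OF x y] xy] by metis
  \<comment> \<open>Via \<open>x \<ominus> z\<close> the two differences along the walk are
    \<open>z\<close> and the negative of \<open>z \<ominus> (x \<ominus> y)\<close>, both units
    modulo \<open>I\<close>.\<close>
  let ?w = "x \<ominus> z"
  have w: "?w \<in> carrier R" "x \<ominus> ?w = z"
    using x z(1) by (simp_all add: minus_minus_self)
  have "\<ominus> (?w \<ominus> y) = z \<ominus> (x \<ominus> y)"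
    using x y z(1) by algebra
  then have "?w \<ominus> y \<notin> M" if "M \<in> maximals_over" for M
    using z(2) that additive_subgroup.a_inv_closed[OF ideal.axioms(1)[OF maximals_overD(2)[OF that]]]
    by metis
  then have "G.awalk (I +> ?w) [(I +> ?w, I +> y)] (I +> y)"
    by (intro awalk_arc w y)
  moreover have "G.awalk (I +> x) [(I +> x, I +> ?w)] (I +> ?w)"
    using z(2) w by (intro awalk_arc x) simp_all
  ultimately have "G.awalk (I +> x) ([(I +> x, I +> ?w)] @ [(I +> ?w, I +> y)]) (I +> y)"
    by (rule G.awalk_appendI[rotated])
  then show ?thesis by (intro exI) (rule conjI, assumption, simp)
qed

text \<open>The first step subtracts 1, which is an arc because 1 is a unit. It moves the difference
  to \<open>y\<close> into every ideal of index 2, and a walk of length 2 completes it.\<close>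

lemma exists_awalk_3:
  assumes x: "x \<in> carrier R" and y: "y \<in> carrier R"
    and xy: "\<And>M. M \<in> index_two_over \<Longrightarrow> x \<ominus> y \<notin> M"
  shows "\<exists>p. G.awalk (I +> x) p (I +> y) \<and> length p = 3"
proof -
  let ?w = "x \<ominus> \<one>"
  have w: "?w \<in> carrier R" "x \<ominus> ?w = \<one>"
    using x by (simp_all add: minus_minus_self)
  have "?w \<ominus> y \<in> M" if M: "M \<in> index_two_over" for M
  proof -
    note MM = index_two_overD[OF M]
    have "(x \<ominus> y) \<ominus> \<one> \<in> M"
      using ideal.index_two_minus_mem[OF maximals_overD(2)[OF MM(1)] MM(2), of "x \<ominus> y" \<one>]
        maximals_overD(4)[OF MM(1)] xy[OF M] x y by simp
    moreover have "(x \<ominus> y) \<ominus> \<one> = ?w \<ominus> y"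
      using x y by algebra
    ultimately show ?thesis by simp
  qed
  then obtain p where p: "G.awalk (I +> ?w) p (I +> y)" "length p = 2"
    using exists_awalk_2[OF w(1) y] by metis
  have "G.awalk (I +> x) [(I +> x, I +> ?w)] (I +> ?w)"
    using maximals_overD(4) w by (intro awalk_arc x) simp_all
  then have "G.awalk (I +> x) ([(I +> x, I +> ?w)] @ p) (I +> y)"
    using p(1) by (rule G.awalk_appendI)
  then show ?thesis using p(2) by (intro exI) (rule conjI, assumption, simp)
qed

text \<open>Each arc changes the residue modulo \<open>M\<close>, and there are only two residues;
  so membership of the difference in \<open>M\<close> alternates along a walk.\<close>

lemma awalk_parity:
  assumes M: "M \<in> index_two_over" and y: "y \<in> carrier R"
  shows "x \<in> carrier R \<Longrightarrow> G.awalk (I +> x) p (I +> y) \<Longrightarrow> x \<ominus> y \<in> M \<longleftrightarrow> even (length p)"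
proof (induction p arbitrary: x)
  case Nil
  then have "x \<ominus> y \<in> I"
    using quotient_eq_iff_same_a_r_cos[OF is_ideal _ y] by (simp add: G.awalk_Nil_iff)
  then show ?case
    using maximals_overD(3)[OF index_two_overD(1)[OF M]] by auto
next
  case (Cons e p)
  note x = Cons.prems(1) and MM = maximals_overD[OF index_two_overD(1)[OF M]]
  have e: "e \<in> arcs cayley" "fst e = I +> x" "G.awalk (snd e) p (I +> y)"
    using Cons.prems(2) by (simp_all add: G.awalk_Cons_iff)
  have "snd e \<in> verts cayley"
    using e(3) by (rule G.awalk_hd_in_verts)
  then obtain z where z: "z \<in> carrier R" "snd e = I +> z"
    unfolding verts_cayley by (metis imageE)
  have "(I +> x, I +> z) \<in> arcs cayley"
    using e(1,2) z(2) by (metis prod.collapse)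
  then have xz: "x \<ominus> z \<notin> M"
    using arc_iff[OF x z(1)] index_two_overD(1)[OF M] by metis
  have IH: "z \<ominus> y \<in> M \<longleftrightarrow> even (length p)"
    using Cons.IH[OF z(1)] e(3) z(2) by simp
  interpret M: ideal M R by (rule MM(2))
  have eq: "(x \<ominus> y) \<ominus> (z \<ominus> y) = x \<ominus> z"
    using minus_cancel_right[OF x z(1) y] .
  \<comment> \<open>The two differences to \<open>y\<close> cannot both lie in \<open>M\<close>, as
    \<open>x \<ominus> z\<close> does not; nor can both lie outside, as index two would again put
    \<open>x \<ominus> z\<close> in \<open>M\<close>.\<close>
  have "x \<ominus> y \<notin> M" if "z \<ominus> y \<in> M"
    using M.a_closed[OF _ M.a_inv_closed[OF that], of "x \<ominus> y"] eq xz
    by (metis a_minus_def)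
  moreover have "x \<ominus> y \<in> M" if "z \<ominus> y \<notin> M"
    using M.index_two_minus_mem[OF index_two_overD(2)[OF M], of "x \<ominus> y" "z \<ominus> y"] that eq xz x y z(1)
    by (metis minus_closed)
  ultimately have "x \<ominus> y \<in> M \<longleftrightarrow> z \<ominus> y \<notin> M" by metis
  then show ?case using IH by simp
qed

text \<open>The length of a single walk decides membership for all ideals of index 2 at once, so no
  mixed case occurs.\<close>

lemma reachable_cases:
  assumes "index_two_over \<noteq> {}" "u \<rightarrow>\<^sup>*\<^bsub>cayley\<^esub> v"
  obtains (even) x y where "x \<in> carrier R" "y \<in> carrier R" "u = I +> x" "v = I +> y"
      "\<And>M. M \<in> index_two_over \<Longrightarrow> x \<ominus> y \<in> M"
  | (odd) x y where "x \<in> carrier R" "y \<in> carrier R" "u = I +> x" "v = I +> y"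
      "\<And>M. M \<in> index_two_over \<Longrightarrow> x \<ominus> y \<notin> M"
proof -
  obtain p where p: "G.awalk u p v"
    using assms(2) by (auto simp: G.reachable_awalk)
  then have "u \<in> verts cayley" "v \<in> verts cayley"
    by (rule G.awalk_hd_in_verts, rule G.awalk_last_in_verts)
  then obtain x y where xy: "x \<in> carrier R" "y \<in> carrier R" "u = I +> x" "v = I +> y"
    unfolding verts_cayley by (metis imageE)
  then have "x \<ominus> y \<in> M \<longleftrightarrow> even (length p)" if "M \<in> index_two_over" for M
    using awalk_parity[OF that xy(2,1)] p by simp
  then show ?thesis
    using even[OF xy] odd[OF xy] by metis
qed

section \<open>The three diameters\<close>

lemma vert_cases:
  assumes "u \<in> verts cayley"
  obtains x where "x \<in> carrier R" "u = I +> x"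
  using assms unfolding verts_cayley by (metis imageE)

text \<open>At even parity the difference lies in all maximal ideals over \<open>I\<close>, hence in
  \<open>I\<close>, and the end points coincide; at odd parity it avoids all of them and is a unit
  modulo \<open>I\<close>. Components are thus complete graphs.\<close>

lemma graph_diameter_eq_1:
  assumes ne: "index_two_over \<noteq> {}" and eq: "maximals_over = index_two_over"
    and I: "\<And>x. x \<in> carrier R \<Longrightarrow> (\<And>M. M \<in> maximals_over \<Longrightarrow> x \<in> M) \<Longrightarrow> x \<in> I"
    and C: "C \<in> G.sccs"
  shows "graph_diameter C = 1"
proof -
  have "graph_diameter C = ereal (real 1)"
  proof (rule G.graph_diameter_scc[OF C])
    fix u v assume uv: "u \<rightarrow>\<^sup>*\<^bsub>cayley\<^esub> v"
    show "\<exists>p. G.awalk u p v \<and> length p \<le> 1"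
      using ne uv
    proof (cases rule: reachable_cases)
      case (even x y)
      then have "u = v"
        using I[of "x \<ominus> y"] eq quotient_eq_iff_same_a_r_cos[OF is_ideal even(1,2)] by simp
      then show ?thesis
        using even rcos_vert by (intro exI[of _ "[]"]) (simp add: G.awalk_Nil_iff)
    next
      case (odd x y)
      then show ?thesis using awalk_arc[OF odd(1,2)] eq
        by (metis One_nat_def length_Cons list.size(3) order_refl)
    qed
  next
    fix u assume "u \<in> verts cayley"
    then obtain x where x: "x \<in> carrier R" "u = I +> x" by (rule vert_cases)
    have y: "x \<ominus> \<one> \<in> carrier R" "x \<ominus> (x \<ominus> \<one>) = \<one>"
      using x(1) by (simp_all add: minus_minus_self)
    have "G.awalk u [(u, I +> (x \<ominus> \<one>))] (I +> (x \<ominus> \<one>))"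
      using awalk_arc[OF x(1) y(1)] maximals_overD(4) unfolding y(2) x(2) by simp
    then have "u \<rightarrow>\<^sup>*\<^bsub>cayley\<^esub> (I +> (x \<ominus> \<one>))"
      using G.reachable_awalk by metis
    moreover have "1 \<le> length p" if "G.awalk u p (I +> (x \<ominus> \<one>))" for p
    proof -
      obtain M where "M \<in> index_two_over" using ne by (metis equals0I)
      then have "odd (length p)"
        using awalk_parity[OF _ y(1) x(1)] that maximals_overD(4) eq unfolding x(2) y(2) by metis
      then show ?thesis by presburger
    qed
    ultimately show "\<exists>v. u \<rightarrow>\<^sup>*\<^bsub>cayley\<^esub> v \<and> (\<forall>p. G.awalk u p v \<longrightarrow> 1 \<le> length p)" by metis
  qed
  then show ?thesis by simp
qed

text \<open>Subtracting \<open>d\<close>, which is nonzero in \<open>R/I\<close> but lies in every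
  maximal ideal over \<open>I\<close>, leads to a different vertex at even parity, hence at distance
  at least 2.\<close>

lemma graph_diameter_eq_2:
  assumes ne: "index_two_over \<noteq> {}" and eq: "maximals_over = index_two_over"
    and d: "d \<in> carrier R" "\<And>M. M \<in> maximals_over \<Longrightarrow> d \<in> M" "d \<notin> I"
    and C: "C \<in> G.sccs"
  shows "graph_diameter C = 2"
proof -
  have "graph_diameter C = ereal (real 2)"
  proof (rule G.graph_diameter_scc[OF C])
    fix u v assume uv: "u \<rightarrow>\<^sup>*\<^bsub>cayley\<^esub> v"
    show "\<exists>p. G.awalk u p v \<and> length p \<le> 2"
      using ne uv
    proof (cases rule: reachable_cases)
      case (even x y)
      then show ?thesis using exists_awalk_2[OF even(1,2)] by (metis order_refl)
    next
      case (odd x y)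
      then show ?thesis using awalk_arc[OF odd(1,2)] eq
        by (intro exI[of _ "[(u, v)]"]) simp
    qed
  next
    fix u assume "u \<in> verts cayley"
    then obtain x where x: "x \<in> carrier R" "u = I +> x" by (rule vert_cases)
    have y: "x \<ominus> d \<in> carrier R" "x \<ominus> (x \<ominus> d) = d"
      using x(1) d(1) by (simp_all add: minus_minus_self)
    have "\<exists>p. G.awalk u p (I +> (x \<ominus> d)) \<and> length p = 2"
      using exists_awalk_2[OF x(1) y(1)] d(2) eq unfolding x(2) y(2) by simp
    then have "u \<rightarrow>\<^sup>*\<^bsub>cayley\<^esub> (I +> (x \<ominus> d))"
      using G.reachable_awalk by metis
    moreover have "2 \<le> length p" if p: "G.awalk u p (I +> (x \<ominus> d))" for p
    proof -
      obtain M where "M \<in> index_two_over" using ne by (metis equals0I)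
      then have "even (length p)"
        using awalk_parity[OF _ y(1) x(1)] p d(2) eq unfolding x(2) y(2) by metis
      moreover have "length p \<noteq> 0"
      proof
        assume "length p = 0"
        then have "I +> x = I +> (x \<ominus> d)"
          using p x(2) by (simp add: G.awalk_Nil_iff)
        then show False
          using quotient_eq_iff_same_a_r_cos[OF is_ideal x(1) y(1)] y(2) d(3) by simp
      qed
      ultimately show ?thesis by presburger
    qed
    ultimately show "\<exists>v. u \<rightarrow>\<^sup>*\<^bsub>cayley\<^esub> v \<and> (\<forall>p. G.awalk u p v \<longrightarrow> 2 \<le> length p)" by metis
  qed
  then show ?thesis by simp
qed

text \<open>Subtracting a \<open>d\<close> that lies in \<open>N\<close> but in no ideal of index 2
  leads to a vertex at odd parity that is not adjacent, so its distance is at least 3.\<close>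

lemma graph_diameter_eq_3:
  assumes ne: "index_two_over \<noteq> {}" and N: "N \<in> maximals_over" "N \<notin> index_two_over"
    and C: "C \<in> G.sccs"
  shows "graph_diameter C = 3"
proof -
  \<comment> \<open>Residues prescribed for \<open>d\<close>: 0 modulo \<open>N\<close>, and 1
    modulo all other maximal ideals over \<open>I\<close>.\<close>
  define c where "c M = (if M = N then \<zero> else \<one>)" for M
  have "c M \<in> carrier R" for M
    by (simp add: c_def)
  then obtain d where d: "d \<in> carrier R" "\<forall>M \<in> maximals_over. d \<ominus> c M \<in> M"
    using chinese_remainder_maximalideals[OF finite_maximals_over maximals_overD(1), of c] by metis
  have "c N = \<zero>"
    by (simp add: c_def)
  then have "d \<ominus> \<zero> \<in> N"
    using d(2) N(1) by metis
  then have dN: "d \<in> N"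
    using d(1) by (simp add: a_minus_def)
  have dM: "d \<notin> M" if M: "M \<in> index_two_over" for M
  proof -
    note MM = index_two_overD(1)[OF M]
    have "c M = \<one>"
      using M N(2) by (metis c_def)
    then have "d \<ominus> \<one> \<in> M"
      using d(2) MM by metis
    then show ?thesis
      using mem_cong[OF maximals_overD(2)[OF MM] d(1) one_closed] maximals_overD(4)[OF MM] by simp
  qed
  have "graph_diameter C = ereal (real 3)"
  proof (rule G.graph_diameter_scc[OF C])
    fix u v assume uv: "u \<rightarrow>\<^sup>*\<^bsub>cayley\<^esub> v"
    show "\<exists>p. G.awalk u p v \<and> length p \<le> 3"
      using ne uv
    proof (cases rule: reachable_cases)
      case (even x y)
      then obtain p where "G.awalk u p v" "length p = 2" using exists_awalk_2[OF even(1,2)] by metis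
      then show ?thesis by (intro exI[of _ p]) simp
    next
      case (odd x y)
      then show ?thesis using exists_awalk_3[OF odd(1,2)] by (metis order_refl)
    qed
  next
    fix u assume "u \<in> verts cayley"
    then obtain x where x: "x \<in> carrier R" "u = I +> x" by (rule vert_cases)
    have y: "x \<ominus> d \<in> carrier R" "x \<ominus> (x \<ominus> d) = d"
      using x(1) d(1) by (simp_all add: minus_minus_self)
    have "\<exists>p. G.awalk u p (I +> (x \<ominus> d)) \<and> length p = 3"
      using exists_awalk_3[OF x(1) y(1)] dM unfolding x(2) y(2) by simp
    then have "u \<rightarrow>\<^sup>*\<^bsub>cayley\<^esub> (I +> (x \<ominus> d))"
      using G.reachable_awalk by metis
    moreover have "3 \<le> length p" if p: "G.awalk u p (I +> (x \<ominus> d))" for p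
    proof -
      obtain M where "M \<in> index_two_over" using ne by (metis equals0I)
      then have "odd (length p)"
        using awalk_parity[OF _ y(1) x(1)] p dM unfolding x(2) y(2) by metis
      moreover have "length p \<noteq> 1"
      proof
        assume "length p = 1"
        then obtain e where e: "p = [e]"
          by (metis One_nat_def length_0_conv length_Suc_conv)
        have "e \<in> arcs cayley" "fst e = I +> x" "snd e = I +> (x \<ominus> d)"
          using p unfolding x(2) e by (simp_all add: G.awalk_Cons_iff G.awalk_Nil_iff)
        then have "(I +> x, I +> (x \<ominus> d)) \<in> arcs cayley"
          by (metis prod.collapse)
        then show False
          using arc_iff[OF x(1) y(1)] y(2) dN N(1) by metis
      qed
      ultimately show ?thesis by presburger
    qed
    ultimately show "\<exists>v. u \<rightarrow>\<^sup>*\<^bsub>cayley\<^esub> v \<and> (\<forall>p. G.awalk u p v \<longrightarrow> 3 \<le> length p)" by metis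
  qed
  then show ?thesis by simp
qed

end

section \<open>Prime ideals of a Dedekind domain\<close>

lemma (in cring) cring_idealI:
  assumes "I \<subseteq> carrier R" "\<zero> \<in> I"
    and "\<And>x y. x \<in> I \<Longrightarrow> y \<in> I \<Longrightarrow> x \<oplus> y \<in> I"
    and mult: "\<And>r x. r \<in> carrier R \<Longrightarrow> x \<in> I \<Longrightarrow> r \<otimes> x \<in> I"
  shows "ideal I R"
proof (rule idealI[OF ring_axioms])
  show "subgroup I (add_monoid R)"
  proof
    fix x assume x: "x \<in> I"
    have "\<ominus> x = (\<ominus> \<one>) \<otimes> x"
      using x assms(1) by (simp add: subsetD l_minus)
    then show "inv\<^bsub>add_monoid R\<^esub> x \<in> I"
      using mult[of "\<ominus> \<one>" x] x by (simp add: a_inv_def)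
  qed (use assms in auto)
  fix x r assume "x \<in> I" "r \<in> carrier R"
  then show "r \<otimes> x \<in> I" "x \<otimes> r \<in> I"
    using mult[of r x] assms(1) by (simp_all add: m_comm subsetD)
qed

text \<open>
  Localised at \<open>Q\<close>, the annihilators of the nonzero elements of \<open>R/aR\<close> are prime when maximal,
  hence equal to \<open>Q\<close>. Finite generation of \<open>Q\<close> then gives a common denominator.
\<close>

lemma (in dedekind_domain) exists_conductor:
  assumes Q: "primeideal Q R" and a: "a \<in> Q" "a \<noteq> \<zero>"
  shows "\<exists>b \<in> carrier R. b \<notin> PIdl a \<and> (\<forall>q \<in> Q. b \<otimes> q \<in> PIdl a)"
proof -
  interpret Q: primeideal Q R by fact
  have ac: "a \<in> carrier R" using a by simp
  interpret P: ideal "PIdl a" R using ac by (rule cgenideal_ideal)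
  have aQ: "PIdl a \<subseteq> Q" using a(1) by (intro cgenideal_minimal Q.is_ideal)
  have oneQ: "\<one> \<notin> Q" using Q.I_notcarr Q.one_imp_carrier by metis
  \<comment> \<open>\<open>Ann b\<close> is the annihilator of the class of \<open>b\<close> modulo
    \<open>a\<close> after localising at \<open>Q\<close>, contracted to \<open>R\<close>;
    \<open>s\<close> is the denominator. Thus 1 lies in \<open>Ann b\<close> exactly when that class
    is zero.\<close>
  define Ann where "Ann b = {r \<in> carrier R. \<exists>s \<in> carrier R. s \<notin> Q \<and> s \<otimes> (r \<otimes> b) \<in> PIdl a}" for b
  have memQ: "s \<otimes> t \<notin> Q" if "s \<in> carrier R" "t \<in> carrier R" "s \<notin> Q" "t \<notin> Q" for s t
    using Q.I_prime[OF that(1,2)] that by metis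
  have Ann_ideal: "ideal (Ann b) R" if b: "b \<in> carrier R" for b
  proof (rule cring_idealI)
    show "Ann b \<subseteq> carrier R" by (simp add: Ann_def)
    show "\<zero> \<in> Ann b"
      using oneQ b by (auto simp: Ann_def intro!: bexI[of _ \<one>])
    fix x y assume "x \<in> Ann b" "y \<in> Ann b"
    then obtain s t where x: "x \<in> carrier R" "s \<in> carrier R" "s \<notin> Q" "s \<otimes> (x \<otimes> b) \<in> PIdl a"
      and y: "y \<in> carrier R" "t \<in> carrier R" "t \<notin> Q" "t \<otimes> (y \<otimes> b) \<in> PIdl a"
      unfolding Ann_def by fast
    have "(s \<otimes> t) \<otimes> ((x \<oplus> y) \<otimes> b) = t \<otimes> (s \<otimes> (x \<otimes> b)) \<oplus> s \<otimes> (t \<otimes> (y \<otimes> b))"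
      using x(1,2) y(1,2) b by algebra
    also have "\<dots> \<in> PIdl a"
      using P.a_closed P.I_l_closed[OF x(4) y(2)] P.I_l_closed[OF y(4) x(2)] by simp
    finally show "x \<oplus> y \<in> Ann b"
      using x y memQ[of s t] by (auto simp: Ann_def intro!: bexI[of _ "s \<otimes> t"])
  next
    fix r x assume r: "r \<in> carrier R" and "x \<in> Ann b"
    then obtain s where x: "x \<in> carrier R" "s \<in> carrier R" "s \<notin> Q" "s \<otimes> (x \<otimes> b) \<in> PIdl a"
      unfolding Ann_def by fast
    have "s \<otimes> ((r \<otimes> x) \<otimes> b) = r \<otimes> (s \<otimes> (x \<otimes> b))"
      using x(1,2) r b by (simp add: m_ac)
    also have "\<dots> \<in> PIdl a"
      using P.I_l_closed[OF x(4) r] .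
    finally show "r \<otimes> x \<in> Ann b"
      using x r by (auto simp: Ann_def)
  qed
  define F where "F = {Ann b | b. b \<in> carrier R \<and> \<one> \<notin> Ann b}"
  have "\<one> \<notin> Ann \<one>"
    using aQ by (auto simp: Ann_def)
  then have "Ann \<one> \<in> F" unfolding F_def mem_Collect_eq using one_closed by metis
  then have ne: "F \<noteq> {}" by (metis empty_iff)
  have "\<exists>M \<in> F. \<forall>N \<in> F. M \<subseteq> N \<longrightarrow> N = M"
  proof (rule exists_maximal_in_ideals[OF ne])
    fix I assume "I \<in> F"
    then obtain b where "b \<in> carrier R" "I = Ann b"
      unfolding F_def mem_Collect_eq by (elim exE conjE)
    then show "ideal I R" using Ann_ideal by simp
  qed
  then obtain M where M: "M \<in> F" "\<forall>N \<in> F. M \<subseteq> N \<longrightarrow> N = M" by (elim bexE)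
  then obtain b where b: "b \<in> carrier R" "\<one> \<notin> Ann b" and MAnn: "M = Ann b"
    unfolding F_def mem_Collect_eq by (elim exE conjE)
  have max: "Ann c = Ann b" if "c \<in> carrier R" "\<one> \<notin> Ann c" "Ann b \<subseteq> Ann c" for c
  proof -
    have "Ann c \<in> F" unfolding F_def mem_Collect_eq using that by metis
    then show ?thesis using M(2) that(3) MAnn by simp
  qed
  \<comment> \<open>By maximality, if \<open>x\<close> does not kill the class of \<open>b\<close>,
    then \<open>x \<otimes> b\<close> has the same annihilator, and \<open>y\<close> belongs to
    it.\<close>
  have prime: "primeideal (Ann b) R"
  proof (rule primeidealI[OF Ann_ideal[OF b(1)] is_cring])
    show "carrier R \<noteq> Ann b" using b(2) by auto
    fix x y assume xy: "x \<in> carrier R" "y \<in> carrier R" "x \<otimes> y \<in> Ann b"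
    have "y \<in> Ann b" if x: "x \<notin> Ann b"
    proof -
      have "Ann b \<subseteq> Ann (x \<otimes> b)"
      proof
        fix r assume "r \<in> Ann b"
        then obtain s where r: "r \<in> carrier R" "s \<in> carrier R" "s \<notin> Q" "s \<otimes> (r \<otimes> b) \<in> PIdl a"
          unfolding Ann_def by fast
        have "s \<otimes> (r \<otimes> (x \<otimes> b)) = x \<otimes> (s \<otimes> (r \<otimes> b))"
          using r(1,2) b xy by (simp add: m_ac)
        also have "\<dots> \<in> PIdl a" using P.I_l_closed[OF r(4) xy(1)] .
        finally show "r \<in> Ann (x \<otimes> b)" using r by (auto simp: Ann_def)
      qed
      moreover have "\<one> \<notin> Ann (x \<otimes> b)"
        using x b xy by (auto simp: Ann_def)
      moreover have "y \<in> Ann (x \<otimes> b)"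
        using xy b by (auto simp: Ann_def m_ac)
      ultimately show ?thesis
        using max[of "x \<otimes> b"] b xy by auto
    qed
    then show "x \<in> Ann b \<or> y \<in> Ann b" by metis
  qed
  have "a \<in> Ann b"
    using ac b oneQ P.I_r_closed[OF cgenideal_self[OF ac]] by (auto simp: Ann_def intro!: bexI[of _ \<one>])
  then have "Ann b \<noteq> {\<zero>}" using a(2) by (metis singletonD)
  then have "maximalideal (Ann b) R"
    by (rule nonzero_prime_maximal[OF prime])
  moreover have "Ann b \<subseteq> Q"
  proof
    fix r assume r: "r \<in> Ann b"
    then obtain s where s: "r \<in> carrier R" "s \<in> carrier R" "s \<notin> Q" "s \<otimes> (r \<otimes> b) \<in> PIdl a"
      unfolding Ann_def by fast
    \<comment> \<open>Outside \<open>Q\<close>, the element \<open>s \<otimes> r\<close> would be a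
      denominator killing the class of \<open>b\<close>.\<close>
    have "s \<otimes> r \<in> Q"
    proof (rule ccontr)
      assume "s \<otimes> r \<notin> Q"
      moreover have "(s \<otimes> r) \<otimes> (\<one> \<otimes> b) \<in> PIdl a"
        using s b by (simp add: m_assoc)
      ultimately have "\<one> \<in> Ann b"
        using s by (auto simp: Ann_def)
      then show False using b(2) by simp
    qed
    then show "r \<in> Q"
      using Q.I_prime[of s r] s by metis
  qed
  moreover have "Q \<noteq> {\<zero>}" using a by (metis singletonD)
  then have "maximalideal Q R" by (rule nonzero_prime_maximal[OF Q])
  ultimately have AnnQ: "Ann b = Q"
    using maximalideal_subset_eq by metis
  obtain A where A: "A \<subseteq> carrier R" "finite A" "Q = Idl A"
    using finetely_gen[OF Q.is_ideal] by metis
  have AQ: "A \<subseteq> Q" using A genideal_self by simp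
  \<comment> \<open>One denominator for all generators of \<open>Q\<close>: the product of the
    individual ones, which stays outside the prime \<open>Q\<close>.\<close>
  have "\<exists>s \<in> carrier R. s \<notin> Q \<and> (\<forall>q \<in> A. s \<otimes> (q \<otimes> b) \<in> PIdl a)"
    using A(2) AQ
  proof (induction A)
    case empty
    then show ?case using oneQ by auto
  next
    case (insert q A)
    then obtain s where s: "s \<in> carrier R" "s \<notin> Q" "\<forall>q \<in> A. s \<otimes> (q \<otimes> b) \<in> PIdl a" by auto
    have "q \<in> Ann b" using insert AnnQ by simp
    then obtain t where t: "q \<in> carrier R" "t \<in> carrier R" "t \<notin> Q" "t \<otimes> (q \<otimes> b) \<in> PIdl a"
      unfolding Ann_def by fast
    have "(s \<otimes> t) \<otimes> (q \<otimes> b) \<in> PIdl a"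
      using s t b P.I_l_closed[OF t(4) s(1)] by (simp add: m_assoc)
    moreover have "(s \<otimes> t) \<otimes> (q' \<otimes> b) \<in> PIdl a" if q': "q' \<in> A" for q'
    proof -
      have "q' \<in> carrier R" using q' insert.prems Q.Icarr by auto
      then have "(s \<otimes> t) \<otimes> (q' \<otimes> b) = t \<otimes> (s \<otimes> (q' \<otimes> b))"
        using s t b by (simp add: m_ac)
      then show ?thesis using P.I_l_closed[OF _ t(2)] s(3) q' by simp
    qed
    ultimately show ?case
      using s t memQ[of s t] by (intro bexI[of _ "s \<otimes> t"]) auto
  qed
  then obtain s where s: "s \<in> carrier R" "s \<notin> Q" "\<forall>q \<in> A. s \<otimes> (q \<otimes> b) \<in> PIdl a" by metis
  \<comment> \<open>The elements that \<open>s \<otimes> b\<close> multiplies into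
    \<open>PIdl a\<close> form an ideal; containing the generators of \<open>Q\<close>, it contains
    \<open>Q\<close>.\<close>
  have "ideal {q \<in> carrier R. (s \<otimes> b) \<otimes> q \<in> PIdl a} R"
  proof (rule cring_idealI)
    fix x y assume "x \<in> {q \<in> carrier R. (s \<otimes> b) \<otimes> q \<in> PIdl a}" "y \<in> {q \<in> carrier R. (s \<otimes> b) \<otimes> q \<in> PIdl a}"
    then show "x \<oplus> y \<in> {q \<in> carrier R. (s \<otimes> b) \<otimes> q \<in> PIdl a}"
      using s b by (simp add: r_distr P.a_closed)
  next
    fix r x assume r: "r \<in> carrier R" and x: "x \<in> {q \<in> carrier R. (s \<otimes> b) \<otimes> q \<in> PIdl a}"
    have "(s \<otimes> b) \<otimes> (r \<otimes> x) = r \<otimes> ((s \<otimes> b) \<otimes> x)"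
      using s b r x by (simp add: m_ac)
    then show "r \<otimes> x \<in> {q \<in> carrier R. (s \<otimes> b) \<otimes> q \<in> PIdl a}"
      using r x P.I_l_closed by simp
  qed (use s b in auto)
  moreover have "A \<subseteq> {q \<in> carrier R. (s \<otimes> b) \<otimes> q \<in> PIdl a}"
  proof
    fix q assume q: "q \<in> A"
    then have "q \<in> carrier R" using A(1) by auto
    then have "(s \<otimes> b) \<otimes> q = s \<otimes> (q \<otimes> b)"
      using s b by (simp add: m_ac)
    then show "q \<in> {q \<in> carrier R. (s \<otimes> b) \<otimes> q \<in> PIdl a}"
      using s(3) q \<open>q \<in> carrier R\<close> by simp
  qed
  ultimately have "Q \<subseteq> {q \<in> carrier R. (s \<otimes> b) \<otimes> q \<in> PIdl a}"
    unfolding A(3) by (rule genideal_minimal)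
  moreover have "s \<otimes> b \<notin> PIdl a"
    using b s by (auto simp: Ann_def)
  ultimately show ?thesis
    using s(1) b(1) by (intro bexI[of _ "s \<otimes> b"]) auto
qed

text \<open>
  The determinant trick is replaced by Noetherianity: the \<open>b\<^sup>n q/a\<^sup>n\<close> with \<open>q \<in> Q\<close> lie in \<open>R\<close>, and a
  linear dependence of one of them on its predecessors is an integral equation for \<open>b/a\<close>.
\<close>

lemma (in dedekind_domain) stable_imp_divides:
  assumes Q: "ideal Q R" "Q \<noteq> {\<zero>}" and a: "a \<in> carrier R" "a \<noteq> \<zero>" and b: "b \<in> carrier R"
    and stable: "\<And>q. q \<in> Q \<Longrightarrow> \<exists>q' \<in> Q. b \<otimes> q = a \<otimes> q'"
  shows "b \<in> PIdl a"
proof -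
  interpret Q: ideal Q R by fact
  let ?K = "fraction_field R"
  interpret K: field ?K by (rule fraction_field_is_field)
  obtain f where f: "\<And>q. q \<in> Q \<Longrightarrow> f q \<in> Q \<and> b \<otimes> q = a \<otimes> f q"
    using stable by metis
  obtain q where q: "q \<in> Q" "q \<noteq> \<zero>"
    using Q(2) Q.zero_closed by fast
  \<comment> \<open>\<open>x n\<close> stands for \<open>b^n q / a^n\<close>, obtained by iterating
    \<open>f\<close> inside \<open>Q\<close>, so that no fractions occur yet.\<close>
  define x where "x n = (f ^^ n) q" for n
  have xQ: "x n \<in> Q" for n
    by (induction n) (use q f x_def in auto)
  have x: "x n \<in> carrier R" for n
    using xQ Q.Icarr by metis
  have bx: "b \<otimes> x n = a \<otimes> x (Suc n)" for n
    using f[OF xQ[of n]] by (simp add: x_def)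
  \<comment> \<open>\<open>N n\<close> is generated by the \<open>x k\<close> with
    \<open>k < n\<close>; this ascending chain becomes stationary, which expresses some
    \<open>x n\<close> through its predecessors.\<close>
  define N where "N = rec_nat {\<zero>} (\<lambda>n I. I <+> PIdl (x n))"
  have N_0: "N 0 = {\<zero>}" and N_Suc: "N (Suc n) = N n <+> PIdl (x n)" for n
    by (simp_all add: N_def)
  have N: "ideal (N n) R" for n
    by (induction n) (simp_all add: N_0 N_Suc zeroideal add_ideals cgenideal_ideal x)
  have N_mono: "N m \<subseteq> N n" if "m \<le> n" for m n
    using that by (rule lift_Suc_mono_le[rotated])
      (simp add: N_Suc ideal_subset_add_cgenideal N x)
  have "\<exists>M \<in> range N. \<forall>I \<in> range N. M \<subseteq> I \<longrightarrow> I = M"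
  proof (rule exists_maximal_in_ideals)
    show "range N \<noteq> {}" by simp
    show "ideal I R" if "I \<in> range N" for I using that N by (metis rangeE)
  qed
  then obtain n where "N (Suc n) = N n"
    using N_mono le_SucI by (metis order_refl rangeE rangeI)
  then have "x n \<in> N n"
    using ideal_subset_add_cgenideal(2)[OF N x] N_Suc by metis
  then have xn: "\<ominus> x n \<in> N n"
    using additive_subgroup.a_inv_closed ideal.axioms(1) N by metis

  \<comment> \<open>Coefficients are listed from the highest index down, as \<open>eval\<close>
    reads them: the head of a list with tail \<open>rs\<close> belongs to
    \<open>x (length rs)\<close>. Negating \<open>x n\<close> above makes the relation
    monic.\<close>
  define ev where "ev = rec_list \<zero> (\<lambda>r rs e. r \<otimes> x (length rs) \<oplus> e)"
  have ev_Nil: "ev [] = \<zero>" and ev_Cons: "ev (r # rs) = r \<otimes> x (length rs) \<oplus> ev rs" for r rs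
    by (simp_all add: ev_def)
  have ev: "ev rs \<in> carrier R" if "set rs \<subseteq> carrier R" for rs
    using that by (induction rs) (simp_all add: ev_Nil ev_Cons x)
  have ex: "\<exists>rs. length rs = n \<and> set rs \<subseteq> carrier R \<and> y = ev rs" if "y \<in> N n" for y n
    using that
  proof (induction n arbitrary: y)
    case 0
    then show ?case by (simp add: N_0 ev_Nil)
  next
    case (Suc n)
    have y: "y \<in> carrier R" using ideal.Icarr[OF N Suc.prems] .
    obtain t where t: "t \<in> carrier R" "y \<ominus> t \<otimes> x n \<in> N n"
      using Suc.prems mem_add_cgenideal[OF N x y] unfolding N_Suc by metis
    obtain rs where rs: "length rs = n" "set rs \<subseteq> carrier R" "y \<ominus> t \<otimes> x n = ev rs"
      using Suc.IH[OF t(2)] by metis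
    have "y = t \<otimes> x n \<oplus> (y \<ominus> t \<otimes> x n)"
      using y t(1) x[of n] by algebra
    then have "y = ev (t # rs)"
      by (simp add: ev_Cons rs)
    then show ?case
      using rs t by (intro exI[of _ "t # rs"]) simp
  qed
  obtain rs where rs: "length rs = n" "set rs \<subseteq> carrier R" "\<ominus> x n = ev rs"
    using ex[OF xn] by metis
  have ev0: "ev (\<one> # rs) = \<zero>"
    using rs x[of n] by (simp add: ev_Cons rs(3)[symmetric] r_neg)

  define \<iota> where "\<iota> r = fraction R r \<one>" for r
  define \<theta> where "\<theta> = fraction R b a"
  have car: "fraction R c s \<in> carrier ?K" if "c \<in> carrier R" "s \<in> carrier R" "s \<noteq> \<zero>" for c s
    using that by (auto simp: carrier_fraction_field)
  have \<iota>: "\<iota> r \<in> carrier ?K" if "r \<in> carrier R" for r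
    using that car by (simp add: \<iota>_def)
  have \<theta>: "\<theta> \<in> carrier ?K"
    using a b car by (simp add: \<theta>_def)
  have \<iota>_mult: "\<iota> (r \<otimes> s) = \<iota> r \<otimes>\<^bsub>?K\<^esub> \<iota> s" if "r \<in> carrier R" "s \<in> carrier R" for r s
    using that by (simp add: \<iota>_def fraction_mult)
  have \<iota>_add: "\<iota> (r \<oplus> s) = \<iota> r \<oplus>\<^bsub>?K\<^esub> \<iota> s" if "r \<in> carrier R" "s \<in> carrier R" for r s
    using that by (simp add: \<iota>_def fraction_add)
  have \<iota>_0: "\<iota> \<zero> = \<zero>\<^bsub>?K\<^esub>" and \<iota>_1: "\<iota> \<one> = \<one>\<^bsub>?K\<^esub>"
    by (simp_all add: \<iota>_def fraction_zero fraction_one)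
  have \<theta>_x: "\<theta> \<otimes>\<^bsub>?K\<^esub> \<iota> (x k) = \<iota> (x (Suc k))" for k
  proof -
    have "b \<otimes> x k \<otimes> \<one> = x (Suc k) \<otimes> (a \<otimes> \<one>)"
      using bx[of k] a b x by (simp add: m_comm)
    then show ?thesis
      using a b x by (simp add: \<theta>_def \<iota>_def fraction_mult fraction_eq_iff)
  qed
  have pow: "\<theta> [^]\<^bsub>?K\<^esub> k \<otimes>\<^bsub>?K\<^esub> \<iota> q = \<iota> (x k)" for k :: nat
  proof (induction k)
    case 0
    then show ?case using \<iota>[of q] q by (simp add: x_def)
  next
    case (Suc k)
    have "\<theta> [^]\<^bsub>?K\<^esub> Suc k \<otimes>\<^bsub>?K\<^esub> \<iota> q = \<theta> \<otimes>\<^bsub>?K\<^esub> (\<theta> [^]\<^bsub>?K\<^esub> k \<otimes>\<^bsub>?K\<^esub> \<iota> q)"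
      using \<theta> \<iota>[of q] q by (simp add: K.m_ac)
    then show ?case by (simp add: Suc \<theta>_x)
  qed
  \<comment> \<open>Multiplication by \<open>\<iota> q\<close> turns the powers of
    \<open>\<theta>\<close> into the \<open>x k\<close>, hence evaluation at \<open>\<theta>\<close>
    into \<open>ev\<close>.\<close>
  have eval: "K.eval (map \<iota> rs) \<theta> \<otimes>\<^bsub>?K\<^esub> \<iota> q = \<iota> (ev rs) \<and> K.eval (map \<iota> rs) \<theta> \<in> carrier ?K"
    if "set rs \<subseteq> carrier R" for rs
    using that
  proof (induction rs)
    case Nil
    then show ?case using \<iota>[of q] q by (simp add: ev_Nil \<iota>_0)
  next
    case (Cons r rs)
    then have r: "r \<in> carrier R" "set rs \<subseteq> carrier R" by simp_all
    define e where "e = K.eval (map \<iota> rs) \<theta>"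
    have e: "e \<otimes>\<^bsub>?K\<^esub> \<iota> q = \<iota> (ev rs)" "e \<in> carrier ?K"
      using Cons r by (simp_all add: e_def)
    have *: "K.eval (map \<iota> (r # rs)) \<theta> = \<iota> r \<otimes>\<^bsub>?K\<^esub> \<theta> [^]\<^bsub>?K\<^esub> length rs \<oplus>\<^bsub>?K\<^esub> e"
      by (simp add: e_def)
    have "K.eval (map \<iota> (r # rs)) \<theta> \<otimes>\<^bsub>?K\<^esub> \<iota> q
        = \<iota> r \<otimes>\<^bsub>?K\<^esub> (\<theta> [^]\<^bsub>?K\<^esub> length rs \<otimes>\<^bsub>?K\<^esub> \<iota> q) \<oplus>\<^bsub>?K\<^esub> e \<otimes>\<^bsub>?K\<^esub> \<iota> q"
      unfolding * using \<iota>[of q] q \<iota>[of r] r \<theta> e(2) by (simp add: K.l_distr K.m_assoc)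
    also have "\<dots> = \<iota> (ev (r # rs))"
      using r x ev by (simp add: pow e(1) ev_Cons \<iota>_mult \<iota>_add)
    finally show ?case
      unfolding * using \<iota>[of r] r \<theta> e(2) by simp
  qed
  have q0: "\<iota> q \<noteq> \<zero>\<^bsub>?K\<^esub>"
    using q by (simp add: \<iota>_def fraction_zero fraction_eq_iff)
  let ?p = "map \<iota> (\<one> # rs)"
  \<comment> \<open>The product with \<open>\<iota> q\<close> vanishes by \<open>ev0\<close>, and
    the nonzero factor \<open>\<iota> q\<close> can be cancelled.\<close>
  have "K.eval ?p \<theta> = \<zero>\<^bsub>?K\<^esub>"
    using eval[of "\<one> # rs"] rs(2) K.integral[of "K.eval ?p \<theta>" "\<iota> q"] \<iota>[of q] q q0
    unfolding ev0 \<iota>_0 by auto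
  moreover have "polynomial\<^bsub>?K\<^esub> (\<iota> ` carrier R) ?p"
  proof (rule K.polynomialI)
    show "set ?p \<subseteq> \<iota> ` carrier R"
      using rs(2) by auto
    show "lead_coeff ?p \<noteq> \<zero>\<^bsub>?K\<^esub>"
      by (simp add: \<iota>_1)
  qed
  ultimately have "integral_over ?K (\<iota> ` carrier R) \<theta>"
    unfolding integral_over_def by (intro exI[of _ ?p]) (simp add: \<iota>_1)
  then have "\<theta> \<in> \<iota> ` carrier R"
    using integrally_closed \<theta> unfolding integrally_closed_def Let_def \<iota>_def by blast
  then obtain r where r: "r \<in> carrier R" "\<theta> = \<iota> r" by fast
  then have "b = r \<otimes> a"
    using a b by (simp add: \<theta>_def \<iota>_def fraction_eq_iff)
  then show ?thesis
    using r(1) unfolding cgenideal_def by fast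
qed

text \<open>The fractional ideal \<open>R + R(b/a)\<close> is inverse to \<open>Q\<close>.\<close>

lemma (in dedekind_domain) prime_inverse:
  assumes Q: "primeideal Q R" "Q \<noteq> {\<zero>}"
  shows "\<exists>a b q q'. a \<in> carrier R \<and> a \<noteq> \<zero> \<and> b \<in> carrier R \<and> q \<in> Q \<and> q' \<in> Q \<and>
    a = a \<otimes> q \<oplus> b \<otimes> q' \<and> (\<forall>q \<in> Q. b \<otimes> q \<in> PIdl a) \<and> b \<notin> PIdl a"
proof -
  interpret Q: primeideal Q R by fact
  obtain a where aQ: "a \<in> Q" "a \<noteq> \<zero>"
    using Q(2) Q.zero_closed by fast
  have a: "a \<in> carrier R" using aQ by simp
  obtain b where b: "b \<in> carrier R" "b \<notin> PIdl a" "\<forall>q \<in> Q. b \<otimes> q \<in> PIdl a"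
    using exists_conductor[OF Q(1) aQ] by metis
  \<comment> \<open>If \<open>b/a\<close> mapped \<open>Q\<close> into itself, \<open>a\<close>
    would divide \<open>b\<close>; so some \<open>p\<close> in \<open>Q\<close> has
    \<open>(b/a) p\<close> outside \<open>Q\<close>.\<close>
  obtain p where p: "p \<in> Q" "\<And>p'. p' \<in> Q \<Longrightarrow> b \<otimes> p \<noteq> a \<otimes> p'"
    using stable_imp_divides[OF Q.is_ideal Q(2) a aQ(2) b(1)] b(2) by metis
  obtain t where t: "t \<in> carrier R" "b \<otimes> p = t \<otimes> a"
    using b(3) p(1) unfolding cgenideal_def by fast
  have tQ: "t \<notin> Q"
    using p(2)[of t] t a by (metis m_comm)
  obtain s where s: "s \<in> carrier R" "\<one> \<ominus> s \<otimes> t \<in> Q"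
    using maximalideal_inverse[OF nonzero_prime_maximal[OF Q] t(1) tQ] by metis
  have pc: "p \<in> carrier R" using p by simp
  \<comment> \<open>With \<open>t = (b/a) p\<close> and \<open>s\<close> inverse to \<open>t\<close>
    modulo \<open>Q\<close>, this is \<open>1 = (1 - s t) + (b/a) s p\<close> with the denominator
    cleared.\<close>
  have "a \<otimes> (\<one> \<ominus> s \<otimes> t) \<oplus> b \<otimes> (s \<otimes> p) = a \<otimes> (\<one> \<ominus> s \<otimes> t) \<oplus> s \<otimes> (b \<otimes> p)"
    using a b(1) s(1) t(1) pc by (simp add: m_ac)
  also have "\<dots> = a"
    unfolding t(2) using a s(1) t(1) by algebra
  finally have "a = a \<otimes> (\<one> \<ominus> s \<otimes> t) \<oplus> b \<otimes> (s \<otimes> p)" by simp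
  moreover have "s \<otimes> p \<in> Q" using Q.I_l_closed[OF p(1) s(1)] .
  ultimately show ?thesis
    using a aQ(2) b s(2) by metis
qed

text \<open>The cofactor \<open>K\<close> is \<open>J + (b/a) J\<close>, the product of
  \<open>J\<close> with the inverse of \<open>Q\<close>. Since \<open>J\<close> lies in
  \<open>Q\<close>, it consists of elements of \<open>R\<close>; its definition clears the
  denominator \<open>a\<close>.\<close>

lemma (in dedekind_domain) prime_contains_imp_divides:
  assumes Q: "primeideal Q R" "Q \<noteq> {\<zero>}" and J: "ideal J R" "J \<subseteq> Q"
  shows "\<exists>K. ideal K R \<and> J = Q \<cdot> K"
proof -
  interpret Q: primeideal Q R by fact
  interpret J: ideal J R by fact
  obtain a b q q' where a: "a \<in> carrier R" "a \<noteq> \<zero>" and b: "b \<in> carrier R"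
    and q: "q \<in> Q" "q' \<in> Q" and eq: "a = a \<otimes> q \<oplus> b \<otimes> q'"
    and bQ: "\<And>q. q \<in> Q \<Longrightarrow> b \<otimes> q \<in> PIdl a"
    using prime_inverse[OF Q] by metis
  define K where "K = {r \<in> carrier R. \<exists>u \<in> J. \<exists>v \<in> J. a \<otimes> r = a \<otimes> u \<oplus> b \<otimes> v}"
  have K: "ideal K R"
  proof (rule cring_idealI)
    show "K \<subseteq> carrier R" by (simp add: K_def)
    show "\<zero> \<in> K"
      using a(1) b by (auto simp: K_def intro!: bexI[of _ \<zero>])
    fix x y assume "x \<in> K" "y \<in> K"
    then obtain u v u' v' where x: "x \<in> carrier R" "u \<in> J" "v \<in> J" "a \<otimes> x = a \<otimes> u \<oplus> b \<otimes> v"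
      and y: "y \<in> carrier R" "u' \<in> J" "v' \<in> J" "a \<otimes> y = a \<otimes> u' \<oplus> b \<otimes> v'"
      unfolding K_def by fast
    have "a \<otimes> (x \<oplus> y) = a \<otimes> (u \<oplus> u') \<oplus> b \<otimes> (v \<oplus> v')"
      using a(1) b x y by (simp add: r_distr a_ac)
    then show "x \<oplus> y \<in> K"
      using x y unfolding K_def by (simp only: mem_Collect_eq) (metis J.a_closed a_closed)
  next
    fix r x assume r: "r \<in> carrier R" and "x \<in> K"
    then obtain u v where x: "x \<in> carrier R" "u \<in> J" "v \<in> J" "a \<otimes> x = a \<otimes> u \<oplus> b \<otimes> v"
      unfolding K_def by fast
    have "a \<otimes> (r \<otimes> x) = r \<otimes> (a \<otimes> x)"
      using a(1) x(1) r by (simp add: m_ac)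
    also have "\<dots> = a \<otimes> (r \<otimes> u) \<oplus> b \<otimes> (r \<otimes> v)"
      unfolding x(4) using a(1) b x r by (simp add: r_distr m_ac)
    finally show "r \<otimes> x \<in> K"
      using x r unfolding K_def by (simp only: mem_Collect_eq) (metis J.I_l_closed m_closed)
  qed
  have "x \<in> J" if "x \<in> Q \<cdot> K" for x
    using that
  proof induction
    case (prod p r)
    then obtain u v where r: "r \<in> carrier R" "u \<in> J" "v \<in> J" "a \<otimes> r = a \<otimes> u \<oplus> b \<otimes> v"
      unfolding K_def by fast
    obtain t where t: "t \<in> carrier R" "b \<otimes> p = t \<otimes> a"
      using bQ[OF prod(1)] unfolding cgenideal_def by fast
    have pc: "p \<in> carrier R" using prod by simp
    have "a \<otimes> (p \<otimes> r) = p \<otimes> (a \<otimes> r)"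
      using a(1) r(1) pc by (simp add: m_ac)
    also have "\<dots> = a \<otimes> (p \<otimes> u) \<oplus> (b \<otimes> p) \<otimes> v"
      unfolding r(4) using a(1) b r pc by (simp add: r_distr m_ac)
    also have "\<dots> = a \<otimes> (p \<otimes> u \<oplus> t \<otimes> v)"
      unfolding t(2) using a(1) t(1) r pc by (simp add: r_distr m_ac)
    finally have "p \<otimes> r = p \<otimes> u \<oplus> t \<otimes> v"
      using a t(1) r pc by (simp add: m_lcancel)
    then show ?case
      using J.a_closed[OF J.I_l_closed[OF r(2) pc] J.I_l_closed[OF r(3) t(1)]] by simp
  qed simp
  moreover have "j \<in> Q \<cdot> K" if j: "j \<in> J" for j
  proof -
    have jc: "j \<in> carrier R" using j by simp
    obtain w where w: "w \<in> carrier R" "b \<otimes> j = w \<otimes> a"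
      using bQ[of j] j J(2) unfolding cgenideal_def by fast
    have "a \<otimes> w = a \<otimes> \<zero> \<oplus> b \<otimes> j"
      using w a by (simp add: m_comm)
    then have wK: "w \<in> K"
      using w(1) j J.zero_closed unfolding K_def by fast
    have "a \<otimes> j = a \<otimes> j \<oplus> b \<otimes> \<zero>"
      using a(1) b jc by simp
    then have jK: "j \<in> K"
      using j jc J.zero_closed unfolding K_def by fast
    have qc: "q \<in> carrier R" "q' \<in> carrier R" using q by simp_all
    \<comment> \<open>Multiplying the relation for \<open>a\<close> by \<open>j\<close> writes
      \<open>j\<close> as \<open>q j + q' w\<close>, where both \<open>j\<close> and
      \<open>w = (b/a) j\<close> lie in \<open>K\<close>.\<close>
    have "a \<otimes> j = (a \<otimes> q \<oplus> b \<otimes> q') \<otimes> j"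
      using eq by simp
    also have "\<dots> = a \<otimes> (q \<otimes> j) \<oplus> q' \<otimes> (b \<otimes> j)"
      using a(1) b qc jc by algebra
    also have "\<dots> = a \<otimes> (q \<otimes> j \<oplus> q' \<otimes> w)"
      unfolding w(2) using a(1) w(1) qc jc by (simp add: r_distr m_ac)
    finally have "j = q \<otimes> j \<oplus> q' \<otimes> w"
      using a w(1) qc jc by (simp add: m_lcancel)
    then show ?thesis
      using ideal_prod.sum[OF ideal_prod.prod[OF q(1) jK] ideal_prod.prod[OF q(2) wK]] by metis
  qed
  ultimately have "J = Q \<cdot> K" by (metis subset_antisym subsetI)
  with K show ?thesis by metis
qed

text \<open>Multiplication by \<open>b/a\<close> maps \<open>Q\<close> into \<open>R\<close>, hence
  \<open>Q \<cdot> Q\<close> into \<open>Q\<close>. If the square were \<open>Q\<close>, then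
  \<open>stable_imp_divides\<close> would make \<open>a\<close> divide \<open>b\<close>.\<close>

lemma (in dedekind_domain) prime_square_neq:
  assumes Q: "primeideal Q R" "Q \<noteq> {\<zero>}"
  shows "Q \<cdot> Q \<noteq> Q"
proof
  assume sq: "Q \<cdot> Q = Q"
  interpret Q: primeideal Q R by fact
  obtain a b where a: "a \<in> carrier R" "a \<noteq> \<zero>" and b: "b \<in> carrier R" "b \<notin> PIdl a"
    and bQ: "\<And>q. q \<in> Q \<Longrightarrow> b \<otimes> q \<in> PIdl a"
    using prime_inverse[OF Q] by metis
  have "\<exists>q' \<in> Q. b \<otimes> q = a \<otimes> q'" if "q \<in> Q \<cdot> Q" for q
    using that
  proof induction
    case (prod p r)
    obtain t where t: "t \<in> carrier R" "b \<otimes> p = t \<otimes> a"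
      using bQ[OF prod(1)] unfolding cgenideal_def by fast
    have pr: "p \<in> carrier R" "r \<in> carrier R" using prod by simp_all
    have "b \<otimes> (p \<otimes> r) = (b \<otimes> p) \<otimes> r"
      using b pr by (simp add: m_assoc)
    also have "\<dots> = a \<otimes> (t \<otimes> r)"
      unfolding t(2) using a t(1) pr by (simp add: m_ac)
    finally show ?case
      using Q.I_l_closed[OF prod(2) t(1)] by metis
  next
    case (sum x y)
    then obtain x' y' where "x' \<in> Q" "b \<otimes> x = a \<otimes> x'" "y' \<in> Q" "b \<otimes> y = a \<otimes> y'"
      by metis
    moreover have "x \<in> carrier R" "y \<in> carrier R"
      using sum.hyps unfolding sq by simp_all
    ultimately show ?case
      using a(1) b(1) by (intro bexI[of _ "x' \<oplus> y'"]) (simp_all add: r_distr)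
  qed
  then have "b \<in> PIdl a"
    using sq by (intro stable_imp_divides[OF Q.is_ideal Q(2) a b(1)]) simp
  with b(2) show False by simp
qed

section \<open>Products in the monoid of ideals\<close>

lemma ideals_set_sel:
  "carrier (ideals_set R) = {I. ideal I R}"
  "I \<otimes>\<^bsub>ideals_set R\<^esub> J = I \<cdot>\<^bsub>R\<^esub> J"
  "\<one>\<^bsub>ideals_set R\<^esub> = carrier R"
  by (simp_all add: ideals_set_def)

lemma (in cring) ideal_pow:
  assumes "ideal I R" shows "ideal (I [^]\<^bsub>ideals_set R\<^esub> (n :: nat)) R"
proof -
  interpret IS: comm_monoid "ideals_set R" by (rule ideals_set_is_comm_monoid)
  show ?thesis
    using IS.nat_pow_closed[of I n] assms by (simp add: ideals_set_sel)
qed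

lemma (in cring) ideal_pow_Suc:
  "I [^]\<^bsub>ideals_set R\<^esub> Suc n = (I [^]\<^bsub>ideals_set R\<^esub> n) \<cdot> I"
  by (simp add: ideals_set_sel nat_pow_def)

lemma (in cring) ideal_pow_1:
  assumes "ideal I R" shows "I [^]\<^bsub>ideals_set R\<^esub> (1 :: nat) = I"
proof -
  interpret IS: comm_monoid "ideals_set R" by (rule ideals_set_is_comm_monoid)
  show ?thesis
    using assms IS.nat_pow_eone[of I] by (simp add: ideals_set_sel)
qed

lemma (in cring) ideal_pow_subset:
  fixes n :: nat
  assumes "ideal I R" "n > 0" shows "I [^]\<^bsub>ideals_set R\<^esub> n \<subseteq> I"
proof (cases n)
  case (Suc k)
  then show ?thesis
    using ideal_prod_inter[OF ideal_pow[OF assms(1), of k] assms(1)] by (simp only: ideal_pow_Suc Int_subset_iff)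
qed (use assms in simp)

lemma (in cring) ideal_pow_subset_square:
  fixes n :: nat
  assumes "ideal I R" "n > 1" shows "I [^]\<^bsub>ideals_set R\<^esub> n \<subseteq> I \<cdot> I"
proof -
  obtain k where n: "n = Suc k" "k > 0"
    using assms(2) by (cases n) simp_all
  have "x \<in> I \<cdot> I" if "x \<in> (I [^]\<^bsub>ideals_set R\<^esub> k) \<cdot> I" for x
    using that
  proof induction
    case (prod i j)
    then show ?case
      using ideal_pow_subset[OF assms(1) n(2)] by (metis ideal_prod.prod subsetD)
  next
    case (sum x y)
    then show ?case by (metis ideal_prod.sum)
  qed
  then show ?thesis
    unfolding n ideal_pow_Suc by (rule subsetI)
qed

lemma (in cring) ideal_finprod:
  assumes "\<And>i. i \<in> A \<Longrightarrow> ideal (f i) R"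
  shows "ideal (finprod (ideals_set R) f A) R"
proof -
  interpret IS: comm_monoid "ideals_set R" by (rule ideals_set_is_comm_monoid)
  have "f \<in> A \<rightarrow> carrier (ideals_set R)"
    using assms by (simp add: ideals_set_sel)
  then show ?thesis
    using IS.finprod_closed by (simp add: ideals_set_sel)
qed

lemma (in cring) ideal_finprod_insert:
  assumes "finite A" "a \<notin> A" "\<And>i. i \<in> insert a A \<Longrightarrow> ideal (f i) R"
  shows "finprod (ideals_set R) f (insert a A) = f a \<cdot> finprod (ideals_set R) f A"
proof -
  interpret IS: comm_monoid "ideals_set R" by (rule ideals_set_is_comm_monoid)
  have "f \<in> A \<rightarrow> carrier (ideals_set R)" "f a \<in> carrier (ideals_set R)"
    using assms(3) by (simp_all add: ideals_set_sel)
  then show ?thesis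
    using IS.finprod_insert[OF assms(1,2)] by (simp add: ideals_set_sel)
qed

lemma (in cring) ideal_finprod_empty: "finprod (ideals_set R) f {} = carrier R"
proof -
  interpret IS: comm_monoid "ideals_set R" by (rule ideals_set_is_comm_monoid)
  show ?thesis by (simp add: ideals_set_sel)
qed

lemma (in cring) ideal_finprod_subset:
  assumes "finite A" "i \<in> A" "\<And>i. i \<in> A \<Longrightarrow> ideal (f i) R"
  shows "finprod (ideals_set R) f A \<subseteq> f i"
proof -
  have A: "insert i (A - {i}) = A" using assms(2) by (rule insert_Diff)
  have "finprod (ideals_set R) f A = f i \<cdot> finprod (ideals_set R) f (A - {i})"
    using ideal_finprod_insert[of "A - {i}" i f] assms unfolding A by simp
  also have "\<dots> \<subseteq> f i"
    using ideal_prod_inter[OF assms(3)[OF assms(2)] ideal_finprod[of "A - {i}" f]] assms(3)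
    by (metis Diff_iff le_infE)
  finally show ?thesis .
qed

lemma (in cring) primeideal_finprod:
  assumes Q: "primeideal Q R" and A: "finite A" "\<And>i. i \<in> A \<Longrightarrow> ideal (f i) R"
    and sub: "finprod (ideals_set R) f A \<subseteq> Q"
  shows "\<exists>i \<in> A. f i \<subseteq> Q"
  using A sub
proof (induction A)
  case empty
  interpret Q: primeideal Q R by fact
  have "\<one> \<in> Q"
    using empty.prems(2) one_closed unfolding ideal_finprod_empty by (rule subsetD)
  then show ?case using Q.one_imp_carrier Q.I_notcarr by metis
next
  case (insert a A)
  have "finprod (ideals_set R) f (insert a A) = f a \<cdot> finprod (ideals_set R) f A"
    using insert.hyps insert.prems(1) by (rule ideal_finprod_insert)
  then have "f a \<cdot> finprod (ideals_set R) f A \<subseteq> Q"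
    using insert.prems(2) by simp
  then have "f a \<subseteq> Q \<or> finprod (ideals_set R) f A \<subseteq> Q"
    by (rule primeideal_divides_ideal_prod[OF Q, rotated 2]) (simp_all add: insert.prems(1) ideal_finprod)
  then show ?case
  proof
    assume "finprod (ideals_set R) f A \<subseteq> Q"
    then have "\<exists>i \<in> A. f i \<subseteq> Q"
      using insert.IH insert.prems(1) by simp
    then show ?thesis by simp
  qed simp
qed

lemma (in cring) primeideal_pow:
  assumes Q: "primeideal Q R" and I: "ideal I R" "I [^]\<^bsub>ideals_set R\<^esub> (n :: nat) \<subseteq> Q"
  shows "I \<subseteq> Q"
  using I(2)
proof (induction n)
  case 0
  interpret Q: primeideal Q R by fact
  have "carrier R \<subseteq> Q" using 0 by (simp add: ideals_set_sel nat_pow_def)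
  then show ?case using Q.one_imp_carrier Q.I_notcarr one_closed by (metis subsetD)
next
  case (Suc n)
  then show ?case
    using primeideal_divides_ideal_prod[OF Q ideal_pow[OF I(1)] I(1)] unfolding ideal_pow_Suc by metis
qed

text \<open>Distinct maximal ideals are comaximal, so their product is their intersection;
  \<open>inj_on\<close> keeps the factors distinct, as a repetition would produce a square.\<close>

lemma (in cring) maximalideals_Inter_subset_finprod:
  assumes "finite A" "inj_on P A" "\<And>i. i \<in> A \<Longrightarrow> maximalideal (P i) R"
    and "x \<in> carrier R" "\<And>i. i \<in> A \<Longrightarrow> x \<in> P i"
  shows "x \<in> finprod (ideals_set R) P A"
  using assms(1-3,5)
proof (induction A)
  case empty
  then show ?case using assms(4) by (simp add: ideal_finprod_empty)
next
  case (insert a A)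
  let ?F = "finprod (ideals_set R) P A"
  have id: "ideal (P i) R" if "i \<in> insert a A" for i
    using insert.prems(2)[OF that] by (rule maximalideal.axioms)
  have F: "ideal ?F R" using id by (intro ideal_finprod) simp
  have a: "maximalideal (P a) R" "ideal (P a) R"
    using insert.prems(2) id by simp_all
  have "\<not> ?F \<subseteq> P a"
  proof
    assume "?F \<subseteq> P a"
    then obtain i where i: "i \<in> A" "P i \<subseteq> P a"
      using primeideal_finprod[OF maximalideal_prime[OF a(1)] insert.hyps(1)] id by (metis insertI2)
    then have "P i = P a"
      using maximalideal_subset_eq a(1) insert.prems(2) by (metis insertI2)
    then have "i = a"
      using insert.prems(1) i(1) by (simp add: inj_on_eq_iff)
    then show False using i(1) insert.hyps(2) by simp
  qed
  then obtain e where e: "e \<in> ?F" "e \<notin> P a" by (metis subsetI)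
  then have ec: "e \<in> carrier R" using ideal.Icarr[OF F] by metis
  obtain t where t: "t \<in> carrier R" "\<one> \<ominus> t \<otimes> e \<in> P a"
    using maximalideal_inverse[OF a(1) ec e(2)] by metis
  have "\<one> = (\<one> \<ominus> t \<otimes> e) \<oplus> t \<otimes> e"
    using t(1) ec by algebra
  moreover have "t \<otimes> e \<in> ?F"
    using ideal.I_l_closed[OF F e(1) t(1)] .
  ultimately have "\<one> \<in> P a <+> ?F"
    using t(2) unfolding set_add_def' by (simp only: UN_iff singleton_iff) metis
  then have "P a <+> ?F = carrier R"
    using ideal.one_imp_carrier[OF add_ideals[OF a(2) F]] by metis
  then have "P a \<cdot> ?F = P a \<inter> ?F"
    by (rule ideal_prod_eq_inter[OF a(2) F])
  moreover have "x \<in> ?F"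
    using insert.IH insert.prems by (simp add: inj_on_def)
  moreover have "x \<in> P a" using insert.prems(3) by simp
  ultimately have "x \<in> P a \<cdot> ?F" by simp
  moreover have "finprod (ideals_set R) P (insert a A) = P a \<cdot> ?F"
    using insert.hyps id by (rule ideal_finprod_insert)
  ultimately show ?case by simp
qed

section \<open>Diameters\<close>

theorem theorem6p3:
  fixes R :: "('a, 'b) ring_scheme" (structure)
    and m :: nat and P :: "nat \<Rightarrow> 'a set" and \<alpha> :: "nat \<Rightarrow> nat" and I J :: "'a set"
  assumes "dedekind_domain R"
    and "m > 0"
    and "inj_on P {1..m}"
    and "\<And>i. i \<in> {1..m} \<Longrightarrow> primeideal (P i) R"
    and "\<And>i. i \<in> {1..m} \<Longrightarrow> card (carrier (R Quot P i)) = 2"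
    and "\<And>i. i \<in> {1..m} \<Longrightarrow> \<alpha> i > 0"
    and "ideal J R"
    and "\<And>Q. primeideal Q R \<Longrightarrow> card (carrier (R Quot Q)) = 2 \<Longrightarrow> \<not> Q divides\<^bsub>ideals_set R\<^esub> J"
    and "I = (\<Otimes>\<^bsub>ideals_set R\<^esub> i \<in> {1..m}. P i [^]\<^bsub>ideals_set R\<^esub> \<alpha> i) \<otimes>\<^bsub>ideals_set R\<^esub> J"
    and "I \<noteq> {\<zero>}"
    and "finite (carrier (R Quot I))"
  shows "(J = carrier R \<and> (\<forall>i \<in> {1..m}. \<alpha> i = 1) \<longrightarrow>
            (\<forall>C \<in> pre_digraph.sccs (with_proj (unitary_cayley_graph (R Quot I))). graph_diameter C = 1)) \<and>
         (J = carrier R \<and> (\<exists>i \<in> {1..m}. \<alpha> i > 1) \<longrightarrow>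
            (\<forall>C \<in> pre_digraph.sccs (with_proj (unitary_cayley_graph (R Quot I))). graph_diameter C = 2)) \<and>
         (J \<noteq> carrier R \<longrightarrow>
            (\<forall>C \<in> pre_digraph.sccs (with_proj (unitary_cayley_graph (R Quot I))). graph_diameter C = 3))"
proof -
  interpret dedekind_domain R by fact
  define F where "F = finprod (ideals_set R) (\<lambda>i. P i [^]\<^bsub>ideals_set R\<^esub> \<alpha> i) {1..m}"
  have prime: "primeideal (P i) R" and P: "ideal (P i) R"
    and maximal: "maximalideal (P i) R" and card: "card (carrier (R Quot P i)) = 2" if "i \<in> {1..m}" for i
    using assms(4)[OF that] assms(5)[OF that] primeideal.index_two_maximal[OF assms(4)[OF that] assms(5)[OF that]]
      primeideal.axioms(1)[OF assms(4)[OF that]] by simp_all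
  have pow: "ideal (P i [^]\<^bsub>ideals_set R\<^esub> \<alpha> i) R" if "i \<in> {1..m}" for i
    using P[OF that] by (rule ideal_pow)
  have F: "ideal F R"
    unfolding F_def using pow by (rule ideal_finprod)
  have IFJ: "I = F \<cdot> J"
    using assms(9) by (simp add: F_def ideals_set_sel)
  have I: "ideal I R" "I \<subseteq> F" "I \<subseteq> J"
    unfolding IFJ using ideal_prod_is_ideal[OF F assms(7)] ideal_prod_inter[OF F assms(7)] by simp_all
  have FP: "F \<subseteq> P i [^]\<^bsub>ideals_set R\<^esub> \<alpha> i" if "i \<in> {1..m}" for i
    unfolding F_def using ideal_finprod_subset[OF finite_atLeastAtMost that, of "\<lambda>i. P i [^]\<^bsub>ideals_set R\<^esub> \<alpha> i"] pow by simp
  have IP: "I \<subseteq> P i" if "i \<in> {1..m}" for i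
    using I(2) FP[OF that] ideal_pow_subset[OF P[OF that] assms(6)[OF that]] by (meson order_trans)
  have nonzero: "M \<noteq> {\<zero>}" if "I \<subseteq> M" for M
  proof
    assume "M = {\<zero>}"
    then have "I = {\<zero>}"
      using that additive_subgroup.zero_closed[OF ideal.axioms(1)[OF I(1)]] by (simp add: subset_singleton_iff) (metis empty_iff)
    with assms(10) show False by simp
  qed
  interpret Q: noetherian_finite_quotient I R
    using I(1) assms(11) is_cring noetherian_ring_axioms
    by (intro noetherian_finite_quotient.intro noetherian_finite_quotient_axioms.intro)
  have P_index: "P i \<in> Q.index_two_over" if "i \<in> {1..m}" for i
    using maximal[OF that] card[OF that] IP[OF that]
    by (simp add: Q.index_two_over_def Q.maximals_over_def)
  \<comment> \<open>A prime of index 2 containing \<open>J\<close> would divide \<open>J\<close>;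
    the division result applies because ideals over the nonzero \<open>I\<close> are
    nonzero.\<close>
  have J_index: "\<not> J \<subseteq> M" if M: "M \<in> Q.index_two_over" for M
  proof
    assume JM: "J \<subseteq> M"
    note MM = Q.index_two_overD[OF M]
    have "primeideal M R"
      using maximalideal_prime[OF Q.maximals_overD(1)[OF MM(1)]] .
    moreover from this obtain K where "ideal K R" "J = M \<cdot> K"
      using prime_contains_imp_divides[OF _ nonzero[OF Q.maximals_overD(3)[OF MM(1)]] assms(7) JM] by metis
    then have "M divides\<^bsub>ideals_set R\<^esub> J"
      by (intro dividesI[of K]) (simp_all add: ideals_set_sel)
    ultimately show False
      using assms(8) MM(2) by metis
  qed
  \<comment> \<open>By primality \<open>M\<close> contains \<open>J\<close> or one of the prime
    powers, hence the corresponding \<open>P i\<close>, which is maximal.\<close>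
  have cases: "J \<subseteq> M \<or> (\<exists>i \<in> {1..m}. M = P i)" if M: "M \<in> Q.maximals_over" for M
  proof -
    note MM = Q.maximals_overD[OF M]
    have "F \<cdot> J \<subseteq> M"
      using MM(3) IFJ by simp
    then have "F \<subseteq> M \<or> J \<subseteq> M"
      by (rule primeideal_divides_ideal_prod[OF maximalideal_prime[OF MM(1)] F assms(7)])
    moreover have "\<exists>i \<in> {1..m}. M = P i" if "F \<subseteq> M"
    proof -
      have "\<exists>i \<in> {1..m}. P i [^]\<^bsub>ideals_set R\<^esub> \<alpha> i \<subseteq> M"
        using pow that unfolding F_def
        by (rule primeideal_finprod[OF maximalideal_prime[OF MM(1)] finite_atLeastAtMost])
      then obtain i where i: "i \<in> {1..m}" "P i [^]\<^bsub>ideals_set R\<^esub> \<alpha> i \<subseteq> M" ..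
      have "P i \<subseteq> M"
        by (rule primeideal_pow[OF maximalideal_prime[OF MM(1)] P[OF i(1)] i(2)])
      then have "P i = M"
        by (rule maximalideal_subset_eq[OF maximal[OF i(1)] MM(1)])
      then show ?thesis using i(1) by (intro bexI[of _ i]) simp_all
    qed
    ultimately show ?thesis by (elim disjE) simp_all
  qed
  have one: "1 \<in> {1..m}" using assms(2) by simp
  then have ne: "Q.index_two_over \<noteq> {}"
    using P_index by (metis empty_iff)
  have over: "M \<in> Q.maximals_over \<longleftrightarrow> (\<exists>i \<in> {1..m}. M = P i)" if J: "J = carrier R" for M
  proof
    assume M: "M \<in> Q.maximals_over"
    then have "\<not> J \<subseteq> M"
      unfolding J using Q.maximals_overD(4) one_closed by (metis subsetD)
    then show "\<exists>i \<in> {1..m}. M = P i" using cases[OF M] by metis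
  next
    assume "\<exists>i \<in> {1..m}. M = P i"
    then show "M \<in> Q.maximals_over"
      using P_index Q.index_two_overD(1) by metis
  qed
  have eq: "Q.maximals_over = Q.index_two_over" if J: "J = carrier R"
  proof (rule Set.set_eqI)
    fix M show "M \<in> Q.maximals_over \<longleftrightarrow> M \<in> Q.index_two_over"
      using over[OF J, of M] P_index Q.index_two_overD(1)[of M] by metis
  qed
  have IF: "I = F" if "J = carrier R"
    unfolding IFJ that using F by (rule ideal_prod_one)
  show ?thesis
  proof (intro conjI impI ballI)
    fix C assume C: "C \<in> pre_digraph.sccs Q.cayley"
    {
      assume "J = carrier R \<and> (\<forall>i \<in> {1..m}. \<alpha> i = 1)"
      then have J: "J = carrier R" and \<alpha>: "\<And>i. i \<in> {1..m} \<Longrightarrow> \<alpha> i = 1" by simp_all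
      interpret IS: comm_monoid "ideals_set R" by (rule ideals_set_is_comm_monoid)
      have "F = finprod (ideals_set R) P {1..m}"
        unfolding F_def using P \<alpha> ideal_pow_1
        by (intro IS.finprod_cong') (simp_all add: ideals_set_sel)
      then have "x \<in> I" if "x \<in> carrier R" "\<And>M. M \<in> Q.maximals_over \<Longrightarrow> x \<in> M" for x
        using maximalideals_Inter_subset_finprod[OF finite_atLeastAtMost assms(3) maximal that(1)]
          that(2) over[OF J] IF[OF J] by metis
      then show "graph_diameter C = 1"
        by (rule Q.graph_diameter_eq_1[OF ne eq[OF J] _ C])
    next
      assume "J = carrier R \<and> (\<exists>i \<in> {1..m}. \<alpha> i > 1)"
      then obtain i where J: "J = carrier R" and i: "i \<in> {1..m}" "\<alpha> i > 1" by metis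
      \<comment> \<open>Otherwise everything common to the maximal ideals over \<open>I\<close>
        would lie in \<open>I\<close>, hence in the square of \<open>P i\<close>; this would force
        \<open>P i\<close> to equal its square.\<close>
      have "\<exists>d \<in> carrier R. (\<forall>M \<in> Q.maximals_over. d \<in> M) \<and> d \<notin> I"
      proof (rule ccontr)
        assume *: "\<not> ?thesis"
        \<comment> \<open>\<open>e\<close> lies in the other maximal ideals, so multiplying by it
          moves \<open>P i\<close> into the whole intersection; as \<open>e\<close> is invertible
          modulo \<open>P i\<close>, this can be undone up to an element of the square.\<close>
        obtain e where e: "e \<in> carrier R" "\<forall>M \<in> Q.maximals_over - {P i}. e \<in> M" "e \<notin> P i"
          using maximalideals_prime_avoidance[OF finite_Diff[OF Q.finite_maximals_over] _ maximal[OF i(1)], of "{P i}"]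
            Q.maximals_overD(1) by (metis DiffD1 DiffD2 insertI1)
        obtain t where t: "t \<in> carrier R" "\<one> \<ominus> t \<otimes> e \<in> P i"
          using maximalideal_inverse[OF maximal[OF i(1)] e(1,3)] by metis
        have "x \<in> P i \<cdot> P i" if x: "x \<in> P i" for x
        proof -
          have xc: "x \<in> carrier R" using ideal.Icarr[OF P[OF i(1)] x] .
          have "x \<otimes> e \<in> M" if M: "M \<in> Q.maximals_over" for M
          proof (cases "M = P i")
            case True
            then show ?thesis using ideal.I_r_closed[OF P[OF i(1)] x e(1)] by simp
          next
            case False
            then show ?thesis
              using ideal.I_l_closed[OF Q.maximals_overD(2)[OF M] _ xc] e(2) M by (metis DiffI singletonD)
          qed
          then have "x \<otimes> e \<in> I"
            using * m_closed[OF xc e(1)] by metis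
          then have "x \<otimes> e \<in> P i \<cdot> P i"
            using I(2) FP[OF i(1)] ideal_pow_subset_square[OF P[OF i(1)] i(2)] by (metis subsetD)
          then have "t \<otimes> (x \<otimes> e) \<in> P i \<cdot> P i"
            by (rule ideal.I_l_closed[OF ideal_prod_is_ideal[OF P[OF i(1)] P[OF i(1)]] _ t(1)])
          moreover have "x \<otimes> (\<one> \<ominus> t \<otimes> e) \<in> P i \<cdot> P i"
            using x t(2) by (rule ideal_prod.prod)
          moreover have "x = x \<otimes> (\<one> \<ominus> t \<otimes> e) \<oplus> t \<otimes> (x \<otimes> e)"
            using xc t(1) e(1) by algebra
          ultimately show ?thesis
            by (metis ideal_prod.sum)
        qed
        then have "P i \<subseteq> P i \<cdot> P i" by (rule subsetI)
        then have "P i \<cdot> P i = P i"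
          using ideal_prod_inter[OF P[OF i(1)] P[OF i(1)]] unfolding Int_absorb by (rule subset_antisym[rotated])
        then show False
          using prime_square_neq[OF prime[OF i(1)] nonzero[OF IP[OF i(1)]]] by metis
      qed
      then obtain d where "d \<in> carrier R" "\<forall>M \<in> Q.maximals_over. d \<in> M" "d \<notin> I" by metis
      then show "graph_diameter C = 2"
        using Q.graph_diameter_eq_2[OF ne eq[OF J] _ _ _ C] by metis
    next
      assume "J \<noteq> carrier R"
      \<comment> \<open>A maximal ideal over \<open>J\<close> also lies over \<open>I\<close>, and
        \<open>J_index\<close> keeps its index from being 2.\<close>
      then obtain N where N: "maximalideal N R" "J \<subseteq> N"
        using exists_maximalideal[OF assms(7)] by metis
      then have "N \<in> Q.maximals_over"
        using I(3) by (simp add: Q.maximals_over_def)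
      moreover have "N \<notin> Q.index_two_over"
        using J_index N(2) by metis
      ultimately show "graph_diameter C = 3"
        using Q.graph_diameter_eq_3[OF ne _ _ C] by metis
    }
  qed
qed

end
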